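(* Let $\mathcal{A}=\langle\Sigma,Q,q_0,\delta,\pi\rangle$ be a game automaton such that for every $q\in Q$, $a\in\Sigma$ with $\delta(q,a)=(L,q_L)\vee(R,q_R)$ or $\delta(q,a)=(L,q_L)\wedge(R,q_R)$ we have $q_L\neq q_R$, let $L\subseteq\mathcal{T}_\Sigma$ be the language recognized by $\mathcal{A}$, and let $\mathcal{M}$ be the MBP corresponding to $\mathcal{A}$. Then $\mu(L)=val(\mathcal{M},s_{q_0})$.
   Context: Trees: $V=\{L,R\}^*$ (root $\epsilon$); a $\Sigma$-tree is $t:V\to\Sigma$; $\mathcal{T}_\Sigma=\Sigma^V$; $\mu$ is the coin-flipping (uniform product) probability measure on $\mathcal{T}_\Sigma$, with $\mu(\{t:t(v_1)=a_1,\dots,t(v_k)=a_k\})=|\Sigma|^{-k}$ for distinct $v_j$. A game automaton $\langle\Sigma,Q,q_0,\delta,\pi\rangle$ has finite state set $Q$, initial state $q_0$, priorities $\pi:Q\to\omega$, and transitions $\delta(q,a)$ each of the form $(L,q_L)\vee(R,q_R)$ or $(L,q_L)\wedge(R,q_R)$. A tree $t$ is accepted iff player $\exists$ wins the game starting at $\langle\epsilon,q_0\rangle$ where: from $\langle x,q\rangle$ with $\delta(q,t(x))=(L,q_L)\vee(R,q_R)$ player $\exists$ moves to $\langle xL,q_L\rangle$ or $\langle xR,q_R\rangle$, and with $\delta(q,t(x))=(L,q_L)\wedge(R,q_R)$ player $\forall$ chooses one of them; an infinite play is won by $\exists$ iff the largest priority of states visited infinitely often is even. A Markov branching play (MBP)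 is $\langle(S,E),(S_P,B_\exists,B_\forall),p,Par\rangle$: a finite directed graph $(S,E)$ with every vertex having a successor, a partition of $S$ into probabilistic, $\exists$-branching and $\forall$-branching states, a probability distribution $p(s)$ on the successors of each $s\in S_P$, and priorities $Par:S\to\omega$. From $s_0$, it generates a random state-labeled tree: root labeled $s_0$; each leaf is extended independently: a leaf labeled $s\in S_P$ gets one child labeled by a successor chosen according to $p(s)$; a leaf labeled by a branching state gets one child for each of its successors, labeled by that successor. This defines a probability measure $\mu_{\mathcal{M}}$ on the branching plays from $s_0$. Each branching play $T$ is a parity game on $T$ in which $\exists$ (resp. $\forall$) chooses a child at vertices labeled by $B_\exists$ (resp. $B_\forall$) states, and $\exists$ wins an infinite path iff the maximal priority of labels occurring infinitely often is even. $val(\mathcal{M},s_0)$ is the $\mu_{\mathcal{M}}$-probability of the set of branching plays from $s_0$ on which $\exists$ has a winning strategy. The MBP corresponding to $\mathcal{A}$: states are a probabilistic state $s_q$ for each $q\in Q$, and for each $(q,a)\in Q\times\Sigma$ a state $s_{q,a}$ which is $\exists$-branching if $\delta(q,a)=(L,q_L)\vee(R,q_R)$ and $\forall$-branching if $\delta(q,a)=(L,q_L)\wedge(R,q_R)$. The successors of $s_q$ are $\{s_{q,a}:a\in\Sigma\}$ with $p(s_q)(s_{q,a})=1/|\Sigma|$; the successors of $s_{q,a}$ are $s_{q_L}$ and $s_{q_R}$; priorities are $Par(s_q)=Par(s_{q,a})=\pi(q)$. *)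

theory Defs
  imports "HOL-Probability.Probability"
begin

datatype dir = DL | DR

text \<open>Vertices V = {L,R}^* are lists of directions; a Sigma-tree is a map dir list => 's.
  The coin-flipping measure is the product of uniform distributions on the finite alphabet.\<close>

definition coin_measure :: "(dir list \<Rightarrow> 's::finite) measure" where
  "coin_measure = PiM UNIV (\<lambda>_::dir list. measure_pmf (pmf_of_set (UNIV :: 's set)))"

definition parity_accepts :: "('x \<Rightarrow> nat) \<Rightarrow> (nat \<Rightarrow> 'x) \<Rightarrow> bool" where
  "parity_accepts pr xs = even (Max (pr ` {x. \<exists>\<^sub>\<infinity> n. xs n = x}))"

text \<open>Or qL qR stands for (L,qL) \<or> (R,qR); And qL qR for (L,qL) \<and> (R,qR).\<close>
datatype 'q trans = Or 'q 'q | And 'q 'q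

type_synonym 'q pos = "dir list \<times> 'q"

definition ga_owner_ex :: "('q \<Rightarrow> 's \<Rightarrow> 'q trans) \<Rightarrow> (dir list \<Rightarrow> 's) \<Rightarrow> 'q pos \<Rightarrow> bool" where
  "ga_owner_ex \<delta> t p = (case \<delta> (snd p) (t (fst p)) of Or _ _ \<Rightarrow> True | And _ _ \<Rightarrow> False)"

definition ga_move :: "('q \<Rightarrow> 's \<Rightarrow> 'q trans) \<Rightarrow> (dir list \<Rightarrow> 's) \<Rightarrow> 'q pos \<Rightarrow> dir \<Rightarrow> 'q pos" where
  "ga_move \<delta> t p d =
     (let (qL, qR) = (case \<delta> (snd p) (t (fst p)) of Or a b \<Rightarrow> (a, b) | And a b \<Rightarrow> (a, b))
      in (case d of DL \<Rightarrow> (fst p @ [DL], qL) | DR \<Rightarrow> (fst p @ [DR], qR)))"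

fun ga_hist :: "'q \<Rightarrow> ('q \<Rightarrow> 's \<Rightarrow> 'q trans) \<Rightarrow> (dir list \<Rightarrow> 's)
      \<Rightarrow> ('q pos list \<Rightarrow> dir) \<Rightarrow> ('q pos list \<Rightarrow> dir) \<Rightarrow> nat \<Rightarrow> 'q pos list" where
  "ga_hist q0 \<delta> t \<sigma> \<tau> 0 = [([], q0)]"
| "ga_hist q0 \<delta> t \<sigma> \<tau> (Suc n) =
     (let h = ga_hist q0 \<delta> t \<sigma> \<tau> n; p = last h
      in h @ [ga_move \<delta> t p (if ga_owner_ex \<delta> t p then \<sigma> h else \<tau> h)])"

definition ga_accepts :: "'q \<Rightarrow> ('q \<Rightarrow> 's \<Rightarrow> 'q trans) \<Rightarrow> ('q \<Rightarrow> nat) \<Rightarrow> (dir list \<Rightarrow> 's) \<Rightarrow> bool" where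
  "ga_accepts q0 \<delta> \<pi> t = (\<exists>\<sigma>. \<forall>\<tau>.
      parity_accepts \<pi> (\<lambda>n. snd (last (ga_hist q0 \<delta> t \<sigma> \<tau> n))))"

definition ga_lang :: "'q \<Rightarrow> ('q \<Rightarrow> 's \<Rightarrow> 'q trans) \<Rightarrow> ('q \<Rightarrow> nat) \<Rightarrow> (dir list \<Rightarrow> 's) set" where
  "ga_lang q0 \<delta> \<pi> = {t. ga_accepts q0 \<delta> \<pi> t}"

datatype kind = Prob | BEx | BAll

record 'st mbp =
  succ :: "'st \<Rightarrow> 'st set"
  kind :: "'st \<Rightarrow> kind"
  prob :: "'st \<Rightarrow> 'st pmf"   \<comment> \<open>only meaningful at probabilistic states\<close>
  par  :: "'st \<Rightarrow> nat"

definition mbp_wf :: "('st::finite) mbp \<Rightarrow> bool" where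
  "mbp_wf M = ((\<forall>s. succ M s \<noteq> {}) \<and> (\<forall>s. kind M s = Prob \<longrightarrow> set_pmf (prob M s) \<subseteq> succ M s))"

text \<open>Vertices of a branching play from s0 are addressed by the list of labels along the path
  from the root (excluding the root); the label of a vertex is the last entry (s0 for the root).
  A branching play is determined by the choice function c giving the child of every probabilistic
  vertex; these choices are independent with distribution p(label), so mu_M is the image of the
  product measure below.\<close>
definition lbl :: "'st \<Rightarrow> 'st list \<Rightarrow> 'st" where
  "lbl s0 w = (if w = [] then s0 else last w)"

definition mbp_space :: "'st mbp \<Rightarrow> 'st \<Rightarrow> ('st list \<Rightarrow> 'st) measure" where
  "mbp_space M s0 = PiM UNIV (\<lambda>w. measure_pmf (prob M (lbl s0 w)))"

text \<open>Play in the parity game on the branching play given by c, with exists-strategy sigma and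
  forall-strategy tau (vertex histories in a tree are determined by the vertex).\<close>
fun bp_play :: "'st mbp \<Rightarrow> 'st \<Rightarrow> ('st list \<Rightarrow> 'st) \<Rightarrow> ('st list \<Rightarrow> 'st) \<Rightarrow> ('st list \<Rightarrow> 'st)
      \<Rightarrow> nat \<Rightarrow> 'st list" where
  "bp_play M s0 c \<sigma> \<tau> 0 = []"
| "bp_play M s0 c \<sigma> \<tau> (Suc n) =
     (let w = bp_play M s0 c \<sigma> \<tau> n
      in w @ [case kind M (lbl s0 w) of Prob \<Rightarrow> c w | BEx \<Rightarrow> \<sigma> w | BAll \<Rightarrow> \<tau> w])"

definition bp_ex_wins :: "'st mbp \<Rightarrow> 'st \<Rightarrow> ('st list \<Rightarrow> 'st) \<Rightarrow> bool" where
  "bp_ex_wins M s0 c = (\<exists>\<sigma>. (\<forall>w. kind M (lbl s0 w) = BEx \<longrightarrow> \<sigma> w \<in> succ M (lbl s0 w)) \<and>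
      (\<forall>\<tau>. (\<forall>w. kind M (lbl s0 w) = BAll \<longrightarrow> \<tau> w \<in> succ M (lbl s0 w)) \<longrightarrow>
         parity_accepts (par M) (\<lambda>n. lbl s0 (bp_play M s0 c \<sigma> \<tau> n))))"

definition mbp_win_set :: "'st mbp \<Rightarrow> 'st \<Rightarrow> ('st list \<Rightarrow> 'st) set" where
  "mbp_win_set M s0 = {c \<in> space (mbp_space M s0). bp_ex_wins M s0 c}"

definition mbp_val :: "'st mbp \<Rightarrow> 'st \<Rightarrow> real" where
  "mbp_val M s0 = measure (completion (mbp_space M s0)) (mbp_win_set M s0)"

text \<open>s_q is Inl q, s_(q,a) is Inr (q,a).\<close>
definition ga_mbp :: "('q \<Rightarrow> 's::finite \<Rightarrow> 'q trans) \<Rightarrow> ('q \<Rightarrow> nat) \<Rightarrow> ('q + 'q \<times> 's) mbp" where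
  "ga_mbp \<delta> \<pi> = \<lparr>
     succ = (\<lambda>s. case s of Inl q \<Rightarrow> range (\<lambda>a. Inr (q, a))
                    | Inr (q, a) \<Rightarrow> (case \<delta> q a of Or qL qR \<Rightarrow> {Inl qL, Inl qR}
                                                 | And qL qR \<Rightarrow> {Inl qL, Inl qR})),
     kind = (\<lambda>s. case s of Inl q \<Rightarrow> Prob
                    | Inr (q, a) \<Rightarrow> (case \<delta> q a of Or _ _ \<Rightarrow> BEx | And _ _ \<Rightarrow> BAll)),
     prob = (\<lambda>s. case s of Inl q \<Rightarrow> map_pmf (\<lambda>a. Inr (q, a)) (pmf_of_set UNIV)
                    | Inr (q, a) \<Rightarrow> return_pmf s),
     par = (\<lambda>s. case s of Inl q \<Rightarrow> \<pi> q | Inr (q, a) \<Rightarrow> \<pi> q) \<rparr>"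

end

theory Submission
  imports Defs
begin

text \<open>
  On a fixed tree both games are parity games on the full binary tree, and they have the same
  winner: a branching play determines a labelled tree (follow the directions and read off the
  letters chosen at the probabilistic states), and since qL and qR differ, its positions correspond
  to the vertices of the branching play. For the same reason distinct tree positions read distinct,
  hence independent, probabilistic choices, so the map from branching plays to trees transports one
  measure to the other.

  What remains is that the winning sets lie in the completion. The winning region of a parity game
  is an alternating fixpoint of monotone operators on sets of positions that act separately on
  each tree. The least fixpoint of such an operator is a measurable family up to a null set: a
  measurable family below it of maximal measure at each of the countably many positions is a
  prefixed point almost everywhere. So no transfinite iteration is needed.
\<close>

section \<open>Measurability of fixpoints\<close>

text \<open>\<open>F t\<close> is only assumed monotone, so countably many iterations need not reach
  the fixpoint. Completeness of \<open>M\<close> absorbs the null set on which a maximal measurable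
  family below the fixpoint may differ from it.\<close>

lemma lfp_measurable:
  fixes F :: "'a \<Rightarrow> 'v::countable set \<Rightarrow> 'v set"
  assumes mono: "\<And>t. mono (F t)"
    and meas: "\<And>X v. (\<And>v. {t \<in> space M. v \<in> X t} \<in> sets M) \<Longrightarrow> {t \<in> space M. v \<in> F t (X t)} \<in> sets M"
    and M: "finite_measure M" "complete_measure M"
  shows "{t \<in> space M. v \<in> lfp (F t)} \<in> sets M"
proof -
  interpret finite_measure M by fact
  interpret complete_measure M by fact
  define \<A> where "\<A> = {X. (\<forall>v. {t \<in> space M. v \<in> X t} \<in> sets M) \<and> (\<forall>t. X t \<subseteq> lfp (F t))}"
  define G where "G v X = emeasure M {t \<in> space M. v \<in> X t}" for v and X :: "'a \<Rightarrow> 'v set"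
  have empty: "(\<lambda>_. {}) \<in> \<A>" by (simp add: \<A>_def)
  have UnA: "(\<lambda>t. \<Union>i. X i t) \<in> \<A>" if "\<And>i. X i \<in> \<A>" for X :: "'i::countable \<Rightarrow> 'a \<Rightarrow> 'v set"
  proof -
    have "{t \<in> space M. v \<in> (\<Union>i. X i t)} = (\<Union>i. {t \<in> space M. v \<in> X i t})" for v by auto
    moreover have "(\<Union>i. {t \<in> space M. v \<in> X i t}) \<in> sets M" for v
      using that by (intro sets.countable_UN') (auto simp: \<A>_def)
    ultimately show ?thesis using that by (simp add: \<A>_def UN_subset_iff)
  qed
  \<comment> \<open>A supremum in \<open>ennreal\<close> is already the supremum of a sequence; this
    keeps the union below countable.\<close>
  have "\<forall>v. \<exists>f :: nat \<Rightarrow> _. range f \<subseteq> \<A> \<and> (SUP X\<in>\<A>. G v X) = (SUP i. G v (f i))"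
  proof
    fix v
    obtain g :: "nat \<Rightarrow> _" where g: "range g \<subseteq> G v ` \<A>" "(SUP X\<in>\<A>. G v X) = (SUP i. g i)"
      using ennreal_SUP_countable_SUP[of \<A> "G v"] empty by auto
    then have "\<forall>i. \<exists>X\<in>\<A>. g i = G v X" by blast
    then obtain f where "\<forall>i. f i \<in> \<A> \<and> g i = G v (f i)" by metis
    with g show "\<exists>f :: nat \<Rightarrow> _. range f \<subseteq> \<A> \<and> (SUP X\<in>\<A>. G v X) = (SUP i. G v (f i))"
      by (intro exI[of _ f]) auto
  qed
  then obtain f :: "'v \<Rightarrow> nat \<Rightarrow> 'a \<Rightarrow> 'v set"
    where f: "\<forall>v. range (f v) \<subseteq> \<A> \<and> (SUP X\<in>\<A>. G v X) = (SUP i. G v (f v i))"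
    using choice by metis
  have fA: "range (f v) \<subseteq> \<A>" and fS: "(SUP X\<in>\<A>. G v X) = (SUP i. G v (f v i))" for v
    using f by simp_all
  \<comment> \<open>The pairs \<open>(v, i)\<close> are countably many, so one family attains the
    supremum at all vertices at once.\<close>
  define Z where "Z t = (\<Union>p. f (fst p) (snd p) t)" for t
  have ZA: "Z \<in> \<A>"
    unfolding Z_def by (rule UnA) (use fA in blast)
  have Zm: "{t \<in> space M. v \<in> Z t} \<in> sets M" for v using ZA by (simp add: \<A>_def)
  have Zl: "Z t \<subseteq> lfp (F t)" for t using ZA by (simp add: \<A>_def)
  have fZ: "f v i t \<subseteq> Z t" for v i t
    unfolding Z_def using UN_upper[of "(v, i)" UNIV "\<lambda>p. f (fst p) (snd p) t"] by simp
  have FZm: "{t \<in> space M. v \<in> F t (Z t)} \<in> sets M" for v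
    by (rule meas) (rule Zm)
  \<comment> \<open>Enlarging \<open>Z\<close> by one application of \<open>F\<close> stays in
    \<open>\<A>\<close>, so by maximality no measure is gained.\<close>
  have Zmax: "G v (\<lambda>t. Z t \<union> F t (Z t)) \<le> G v Z" for v
  proof -
    have "(\<lambda>t. Z t \<union> F t (Z t)) \<in> \<A>"
    proof -
      have "{t \<in> space M. v \<in> Z t \<or> v \<in> F t (Z t)} =
        {t \<in> space M. v \<in> Z t} \<union> {t \<in> space M. v \<in> F t (Z t)}" for v by auto
      then have "{t \<in> space M. v \<in> Z t \<or> v \<in> F t (Z t)} \<in> sets M" for v
        using sets.Un[OF Zm FZm] by simp
      moreover have "F t (Z t) \<subseteq> lfp (F t)" for t
        using monoD[OF mono[of t] Zl[of t]] lfp_unfold[OF mono[of t], symmetric] by simp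
      ultimately show ?thesis using Zl by (simp add: \<A>_def)
    qed
    then have "G v (\<lambda>t. Z t \<union> F t (Z t)) \<le> (SUP X\<in>\<A>. G v X)"
      by (rule SUP_upper)
    also have "\<dots> = (SUP i. G v (f v i))" by (rule fS)
    also have "\<dots> \<le> G v Z"
      unfolding G_def by (intro SUP_least emeasure_mono Zm) (use fZ in blast)
    finally show ?thesis .
  qed
  have "AE t in M. v \<in> F t (Z t) \<longrightarrow> v \<in> Z t" for v
  proof -
    let ?A = "{t \<in> space M. v \<in> Z t}" and ?B = "{t \<in> space M. v \<in> Z t \<union> F t (Z t)}"
    have B: "?B = ?A \<union> {t \<in> space M. v \<in> F t (Z t)}" by auto
    have Bm: "?B \<in> sets M" unfolding B using Zm FZm by blast
    \<comment> \<open>Finiteness of the measure permits the subtraction; without a gain in measure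
      the added part is null.\<close>
    have "emeasure M (?B - ?A) = emeasure M ?B - emeasure M ?A"
      using Zm Bm by (intro emeasure_Diff) auto
    also have "\<dots> = 0" using Zmax[of v] by (simp add: G_def diff_eq_0_iff_ennreal less_top[symmetric])
    finally have "?B - ?A \<in> null_sets M" using Zm Bm by auto
    then show ?thesis by (rule AE_I') auto
  qed
  then have "AE t in M. \<forall>v. v \<in> F t (Z t) \<longrightarrow> v \<in> Z t"
    by (simp add: AE_all_countable)
  then have "AE t in M. lfp (F t) = Z t"
  proof (rule AE_mp, intro AE_I2 impI)
    fix t assume "\<forall>v. v \<in> F t (Z t) \<longrightarrow> v \<in> Z t"
    then have "lfp (F t) \<subseteq> Z t" by (intro lfp_lowerbound) blast
    with Zl show "lfp (F t) = Z t" by blast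
  qed
  then have "AE t in M. t \<in> {t \<in> space M. v \<in> Z t} \<longleftrightarrow> t \<in> {t \<in> space M. v \<in> lfp (F t)}"
    by auto
  then show ?thesis using Zm[of v] by (rule in_sets_AE) blast
qed

text \<open>Serves to reduce measurability of greatest fixpoints to least ones, and to exchange the
  players in \<open>Compl_region\<close>.\<close>

lemma gfp_conv_lfp: "gfp f = - lfp (\<lambda>Y. - f (- Y))" for f :: "'v set \<Rightarrow> 'v set"
proof (rule antisym)
  show "gfp f \<subseteq> - lfp (\<lambda>Y. - f (- Y))"
    by (rule gfp_least) (metis Compl_subset_Compl_iff double_compl lfp_lowerbound)
  show "- lfp (\<lambda>Y. - f (- Y)) \<subseteq> gfp f"
  proof -
    have "- gfp f \<subseteq> lfp (\<lambda>Y. - f (- Y))"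
      by (rule lfp_greatest) (metis Compl_subset_Compl_iff double_compl gfp_upperbound)
    then show ?thesis by blast
  qed
qed

lemma gfp_measurable:
  fixes F :: "'a \<Rightarrow> 'v::countable set \<Rightarrow> 'v set"
  assumes mono: "\<And>t. mono (F t)"
    and meas: "\<And>X v. (\<And>v. {t \<in> space M. v \<in> X t} \<in> sets M) \<Longrightarrow> {t \<in> space M. v \<in> F t (X t)} \<in> sets M"
    and M: "finite_measure M" "complete_measure M"
  shows "{t \<in> space M. v \<in> gfp (F t)} \<in> sets M"
proof -
  have compl: "{t \<in> space M. v \<in> - X t} \<in> sets M" if "{t \<in> space M. v \<in> X t} \<in> sets M" for X and v :: 'v
    using sets.sets_Collect_neg[OF that] by simp
  have "{t \<in> space M. v \<in> lfp (\<lambda>Y. - F t (- Y))} \<in> sets M"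
  proof (rule lfp_measurable[where F = "\<lambda>t Y. - F t (- Y)", OF _ _ M])
    show "mono (\<lambda>Y. - F t (- Y))" for t
      using mono by (simp add: mono_def)
    show "{t \<in> space M. v \<in> - F t (- X t)} \<in> sets M"
      if "\<And>v. {t \<in> space M. v \<in> X t} \<in> sets M" for X v
      by (rule compl, rule meas[of "\<lambda>t. - X t"], rule compl, rule that)
  qed
  from compl[OF this] show ?thesis by (simp add: gfp_conv_lfp)
qed

section \<open>Parity games on the binary tree\<close>

text \<open>For a bounded sequence \<open>p\<close> is the limit superior. \<open>P\<close> is a
  parameter so that the opponent's objective is the same notion with \<open>P\<close>
  negated.\<close>

definition dominant :: "(nat \<Rightarrow> bool) \<Rightarrow> (nat \<Rightarrow> nat) \<Rightarrow> bool" where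
  "dominant P a \<longleftrightarrow> (\<exists>p. P p \<and> (\<exists>\<^sub>\<infinity>n. a n = p) \<and> (\<forall>\<^sub>\<infinity>n. a n \<le> p))"

lemma dominant_contradictory:
  assumes "dominant P a" "dominant (\<lambda>p. \<not> P p) a"
  shows False
proof -
  have le: "p \<le> q" if "\<exists>\<^sub>\<infinity>n. a n = p" "\<forall>\<^sub>\<infinity>n. a n \<le> q" for p q
    using frequently_eventually_frequently[OF that]
    by (auto dest!: frequently_ex)
  show False using assms le unfolding dominant_def by (metis le_antisym)
qed

lemma dominant_shift: "dominant P (\<lambda>n. a (m + n)) \<longleftrightarrow> dominant P a"
proof -
  have "(\<forall>\<^sub>\<infinity>n. Q (m + n)) \<longleftrightarrow> (\<forall>\<^sub>\<infinity>n. Q n)" for Q :: "nat \<Rightarrow> bool"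
    using eventually_sequentially_seg[of Q m] by (simp add: cofinite_eq_sequentially add.commute)
  from this[of "\<lambda>n. a n \<le> p" for p] this[of "\<lambda>n. \<not> a n = p" for p] show ?thesis
    unfolding dominant_def frequently_def by presburger
qed

text \<open>One move on the tree corresponds to two states \<open>s_q\<close>,
  \<open>s_(q,a)\<close> of equal priority in the branching play, so every priority is doubled
  there.\<close>

lemma dominant_div2: "dominant P (\<lambda>n. a (n div 2)) \<longleftrightarrow> dominant P a"
proof -
  have *: "(\<forall>\<^sub>\<infinity>n. Q (n div 2)) \<longleftrightarrow> (\<forall>\<^sub>\<infinity>n. Q n)" for Q :: "nat \<Rightarrow> bool"
  proof -
    have "(\<forall>n\<ge>2 * m. Q (n div 2))" if "\<forall>n\<ge>m. Q n" for m using that by auto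
    moreover have "(\<forall>n\<ge>m. Q n)" if "\<forall>n\<ge>m. Q (n div 2)" for m
    proof (intro allI impI)
      fix n assume "m \<le> n" then show "Q n" using that[rule_format, of "2 * n"] by simp
    qed
    ultimately show ?thesis unfolding MOST_nat_le by metis
  qed
  from *[of "\<lambda>n. a n \<le> p" for p] *[of "\<lambda>n. \<not> a n = p" for p] show ?thesis
    unfolding dominant_def frequently_def by presburger
qed

text \<open>Over a finite type some element recurs and eventually only recurring ones occur, so the
  maximal recurring priority is an eventual bound. For the converse, an odd maximum makes the
  negated condition dominant.\<close>

lemma parity_accepts_iff_dominant:
  fixes xs :: "nat \<Rightarrow> 'x::finite"
  shows "parity_accepts pr xs \<longleftrightarrow> dominant even (\<lambda>n. pr (xs n))"
proof -
  define I where "I = {x. \<exists>\<^sub>\<infinity>n. xs n = x}"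
  have "\<exists>x. \<exists>\<^sub>\<infinity>n. xs n = x"
    using INFM_finite_Bex_distrib[of UNIV "\<lambda>x n. xs n = x"] by simp
  then have ne: "I \<noteq> {}" by (auto simp: I_def)
  have "Max (pr ` I) \<in> pr ` I"
    by (rule Max_in) (use ne in auto)
  then obtain x where x: "x \<in> I" "pr x = Max (pr ` I)" by auto
  have inf: "\<exists>\<^sub>\<infinity>n. pr (xs n) = Max (pr ` I)"
    using x by (auto simp: I_def elim: frequently_elim1)
  have "\<forall>\<^sub>\<infinity>n. \<forall>y\<in>-I. xs n \<noteq> y"
    by (subst MOST_finite_Ball_distrib) (simp_all add: I_def not_frequently)
  then have bound: "\<forall>\<^sub>\<infinity>n. pr (xs n) \<le> Max (pr ` I)"
  proof (rule eventually_mono)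
    fix n assume "\<forall>y\<in>-I. xs n \<noteq> y"
    then have "xs n \<in> I" by blast
    then show "pr (xs n) \<le> Max (pr ` I)" by simp
  qed
  have "dominant even (\<lambda>n. pr (xs n))" if "even (Max (pr ` I))"
    using that inf bound unfolding dominant_def by blast
  moreover have "dominant (\<lambda>p. \<not> even p) (\<lambda>n. pr (xs n))" if "odd (Max (pr ` I))"
    using that inf bound unfolding dominant_def by blast
  ultimately show ?thesis
    unfolding parity_accepts_def I_def[symmetric] using dominant_contradictory by blast
qed

instance dir :: finite
proof
  have "UNIV = {DL, DR}" by (auto intro: dir.exhaust)
  then show "finite (UNIV :: dir set)" by (metis finite.emptyI finite.insertI)
qed

text \<open>In the abstract game, vertices are lists of directions with the last move first, so that the
  children of v are the lists d # v. A strategy depending on the vertex alone loses nothing, since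
  the vertex determines the history.\<close>

definition step :: "dir list set \<Rightarrow> (dir list \<Rightarrow> dir) \<Rightarrow> dir list \<Rightarrow> dir list \<Rightarrow> bool" where
  "step E S v w \<longleftrightarrow> (\<exists>d. w = d # v) \<and> (v \<in> E \<longrightarrow> w = S v # v)"

text \<open>The opponent's choices are absorbed into the quantification over all paths that respect
  \<open>S\<close>.\<close>

definition ex_wins :: "(nat \<Rightarrow> bool) \<Rightarrow> dir list set \<Rightarrow> (dir list \<Rightarrow> nat) \<Rightarrow> bool" where
  "ex_wins P E pr \<longleftrightarrow> (\<exists>S. \<forall>\<rho>. \<rho> 0 = [] \<and> (\<forall>n. step E S (\<rho> n) (\<rho> (Suc n))) \<longrightarrow>
     dominant P (\<lambda>n. pr (\<rho> n)))"

definition cpre :: "dir list set \<Rightarrow> dir list set \<Rightarrow> dir list set" where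
  "cpre E X = {v. if v \<in> E then \<exists>d. d # v \<in> X else \<forall>d. d # v \<in> X}"

text \<open>Where the game for \<open>k\<close> stops, the game for \<open>k + 1\<close> also stops
  if the priority exceeds \<open>k\<close>; at priority exactly \<open>k\<close> it continues, and
  \<open>Y\<close> collects the good vertices to continue from.\<close>

definition select_above :: "(dir list \<Rightarrow> nat) \<Rightarrow> nat \<Rightarrow> dir list set \<Rightarrow> dir list set \<Rightarrow> dir list set" where
  "select_above pr k X Y = {v. if k < pr v then v \<in> X else v \<in> Y}"

text \<open>The positions from which the player with vertices E wins the game that stops at the first
  later vertex of priority at least k, where X decides the winner, and that is decided by P on the
  dominant priority if there is no such vertex. The player goes from k to k + 1 by replaying from
  the vertices of priority k, infinitely often only if P k holds. Only the elements of X of priority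
  at least k matter.\<close>

primrec region :: "(nat \<Rightarrow> bool) \<Rightarrow> dir list set \<Rightarrow> (dir list \<Rightarrow> nat) \<Rightarrow> nat \<Rightarrow> dir list set \<Rightarrow> dir list set" where
  "region P E pr 0 X = cpre E X"
| "region P E pr (Suc k) X =
    (if P k then gfp (\<lambda>Y. region P E pr k (select_above pr k X Y))
     else lfp (\<lambda>Y. region P E pr k (select_above pr k X Y)))"

section \<open>Monotonicity, duality and measurability of regions\<close>

lemma ex_dir: "(\<exists>d. Q d) \<longleftrightarrow> Q DL \<or> Q DR" and all_dir: "(\<forall>d. Q d) \<longleftrightarrow> Q DL \<and> Q DR"
  by (metis dir.exhaust)+

lemma select_above_mono: "X \<subseteq> X' \<Longrightarrow> Y \<subseteq> Y' \<Longrightarrow> select_above pr k X Y \<subseteq> select_above pr k X' Y'"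
  by (auto simp: select_above_def)

lemma region_mono: "X \<subseteq> X' \<Longrightarrow> region P E pr k X \<subseteq> region P E pr k X'"
proof (induction k arbitrary: X X')
  case 0
  then show ?case by (auto simp: cpre_def split: if_splits)
next
  case (Suc k)
  show ?case
    using Suc.IH[OF select_above_mono[OF Suc.prems order_refl]] by (simp add: lfp_mono gfp_mono)
qed

lemma mono_region_select_above: "mono (\<lambda>Y. region P E pr k (select_above pr k X Y))"
  by (intro monoI region_mono select_above_mono order_refl)

lemma Compl_select_above: "- select_above pr k X Y = select_above pr k (- X) (- Y)"
  by (auto simp: select_above_def)

text \<open>Complementation exchanges the fixpoints at every level and the two kinds of choice in
  \<open>cpre\<close>. Determinacy of the game rests on this.\<close>

lemma Compl_region: "- region P E pr k X = region (\<lambda>p. \<not> P p) (- E) pr k (- X)"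
proof (induction k arbitrary: X)
  case 0
  then show ?case by (auto simp: cpre_def)
next
  case (Suc k)
  have "- region P E pr k (select_above pr k X Y) =
      region (\<lambda>p. \<not> P p) (- E) pr k (select_above pr k (- X) (- Y))" for Y
    by (simp add: Suc.IH Compl_select_above)
  \<comment> \<open>The first equation serves the case \<open>P k\<close>, the second the case of a
    least fixpoint on the left.\<close>
  then have "- region P E pr k (select_above pr k X (- Y)) =
      region (\<lambda>p. \<not> P p) (- E) pr k (select_above pr k (- X) Y)"
    and "- region (\<lambda>p. \<not> P p) (- E) pr k (select_above pr k (- X) (- Y)) =
      region P E pr k (select_above pr k X Y)" for Y
    by (metis double_compl)+
  then show ?case
    by (simp add: gfp_conv_lfp)
qed

lemma region_measurable:
  assumes M: "finite_measure M" "complete_measure M"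
    and E: "\<And>v. {t \<in> space M. v \<in> E t} \<in> sets M"
    and pr: "\<And>v k. {t \<in> space M. k < pr t v} \<in> sets M"
    and X: "\<And>v. {t \<in> space M. v \<in> X t} \<in> sets M"
  shows "{t \<in> space M. v \<in> region P (E t) (pr t) k (X t)} \<in> sets M"
  using X
proof (induction k arbitrary: X v)
  case 0
  have [measurable]: "Measurable.pred M (\<lambda>t. v \<in> E t)" "Measurable.pred M (\<lambda>t. v \<in> X t)" for v
    using E 0 by (simp_all add: pred_def)
  have "Measurable.pred M (\<lambda>t. (v \<in> E t \<longrightarrow> DL # v \<in> X t \<or> DR # v \<in> X t) \<and>
      (v \<notin> E t \<longrightarrow> DL # v \<in> X t \<and> DR # v \<in> X t))"
    by measurable
  moreover have "{t \<in> space M. v \<in> cpre (E t) (X t)} = {t \<in> space M.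
      (v \<in> E t \<longrightarrow> DL # v \<in> X t \<or> DR # v \<in> X t) \<and> (v \<notin> E t \<longrightarrow> DL # v \<in> X t \<and> DR # v \<in> X t)}"
    by (auto simp: cpre_def ex_dir all_dir)
  ultimately show ?case by (simp add: pred_def)
next
  case (Suc k)
  \<comment> \<open>This is what the fixpoint lemmas ask for: the operator preserves measurable
    families.\<close>
  have *: "{t \<in> space M. v \<in> region P (E t) (pr t) k (select_above (pr t) k (X t) (Y t))} \<in> sets M"
    if "\<And>v. {t \<in> space M. v \<in> Y t} \<in> sets M" for Y v
  proof (rule Suc.IH)
    fix v
    have [measurable]: "Measurable.pred M (\<lambda>t. k < pr t v)" "Measurable.pred M (\<lambda>t. v \<in> X t)"
        "Measurable.pred M (\<lambda>t. v \<in> Y t)"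
      using pr Suc.prems that by (simp_all add: pred_def)
    have "Measurable.pred M (\<lambda>t. (k < pr t v \<longrightarrow> v \<in> X t) \<and> (\<not> k < pr t v \<longrightarrow> v \<in> Y t))"
      by measurable
    moreover have "{t \<in> space M. v \<in> select_above (pr t) k (X t) (Y t)} =
        {t \<in> space M. (k < pr t v \<longrightarrow> v \<in> X t) \<and> (\<not> k < pr t v \<longrightarrow> v \<in> Y t)}"
      by (auto simp: select_above_def)
    ultimately show "{t \<in> space M. v \<in> select_above (pr t) k (X t) (Y t)} \<in> sets M"
      by (simp add: pred_def)
  qed
  show ?case
  proof (cases "P k")
    case True
    have "{t \<in> space M. v \<in> gfp (\<lambda>Y. region P (E t) (pr t) k (select_above (pr t) k (X t) Y))} \<in> sets M"
      by (rule gfp_measurable[where F = "\<lambda>t Y. region P (E t) (pr t) k (select_above (pr t) k (X t) Y)",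
            OF mono_region_select_above * M])
    with True show ?thesis by simp
  next
    case False
    have "{t \<in> space M. v \<in> lfp (\<lambda>Y. region P (E t) (pr t) k (select_above (pr t) k (X t) Y))} \<in> sets M"
      by (rule lfp_measurable[where F = "\<lambda>t Y. region P (E t) (pr t) k (select_above (pr t) k (X t) Y)",
            OF mono_region_select_above * M])
    with False show ?thesis by simp
  qed
qed

text \<open>Index 0 is exempt from the priority conditions: the start vertex does not stop the game,
  so play can restart at a vertex of priority \<open>k\<close>. The first clause restricts only the
  steps before \<open>n\<close>, because what happens after stopping is irrelevant.\<close>

definition secures :: "(nat \<Rightarrow> bool) \<Rightarrow> dir list set \<Rightarrow> (dir list \<Rightarrow> nat) \<Rightarrow> nat \<Rightarrow> dir list set \<Rightarrow>
    (dir list \<Rightarrow> dir) \<Rightarrow> dir list \<Rightarrow> bool" where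
  "secures P E pr k X S x \<longleftrightarrow> (\<forall>\<rho>. \<rho> 0 = x \<longrightarrow>
     (\<forall>n>0. (\<forall>i<n. step E S (\<rho> i) (\<rho> (Suc i))) \<and> (\<forall>i. 0 < i \<and> i < n \<longrightarrow> pr (\<rho> i) < k) \<and> k \<le> pr (\<rho> n)
        \<longrightarrow> \<rho> n \<in> X) \<and>
     ((\<forall>i. step E S (\<rho> i) (\<rho> (Suc i))) \<and> (\<forall>i>0. pr (\<rho> i) < k) \<longrightarrow> dominant P (\<lambda>n. pr (\<rho> n))))"

lemma securesI:
  assumes "\<And>\<rho> n. \<rho> 0 = x \<Longrightarrow> 0 < n \<Longrightarrow> (\<And>i. i < n \<Longrightarrow> step E S (\<rho> i) (\<rho> (Suc i))) \<Longrightarrow>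
      (\<And>i. 0 < i \<Longrightarrow> i < n \<Longrightarrow> pr (\<rho> i) < k) \<Longrightarrow> k \<le> pr (\<rho> n) \<Longrightarrow> \<rho> n \<in> X"
    and "\<And>\<rho>. \<rho> 0 = x \<Longrightarrow> (\<And>i. step E S (\<rho> i) (\<rho> (Suc i))) \<Longrightarrow> (\<And>i. 0 < i \<Longrightarrow> pr (\<rho> i) < k) \<Longrightarrow>
      dominant P (\<lambda>n. pr (\<rho> n))"
  shows "secures P E pr k X S x"
  using assms unfolding secures_def by blast

text \<open>Together with \<open>secures_forever\<close> this applies a guarantee to the part of a
  play from time \<open>m\<close> on, as is needed when strategies are switched.\<close>

lemma secures_reach:
  assumes S: "secures P E pr k X S (\<rho> m)" and "m < n"
    and "\<And>i. m \<le> i \<Longrightarrow> i < n \<Longrightarrow> step E S (\<rho> i) (\<rho> (Suc i))"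
    and "\<And>i. m < i \<Longrightarrow> i < n \<Longrightarrow> pr (\<rho> i) < k" and "k \<le> pr (\<rho> n)"
  shows "\<rho> n \<in> X"
proof -
  let ?\<rho> = "\<lambda>i. \<rho> (m + i)"
  have "?\<rho> 0 = \<rho> m" by simp
  moreover have "0 < n - m" "\<forall>i<n - m. step E S (?\<rho> i) (?\<rho> (Suc i))"
    "\<forall>i. 0 < i \<and> i < n - m \<longrightarrow> pr (?\<rho> i) < k" "k \<le> pr (?\<rho> (n - m))"
    using assms(2-) by auto
  ultimately have "?\<rho> (n - m) \<in> X" 
    using S[unfolded secures_def, THEN spec, of ?\<rho>] by blast
  then show ?thesis using \<open>m < n\<close> by simp
qed

lemma secures_forever:
  assumes S: "secures P E pr k X S (\<rho> m)"
    and "\<And>i. m \<le> i \<Longrightarrow> step E S (\<rho> i) (\<rho> (Suc i))" and "\<And>i. m < i \<Longrightarrow> pr (\<rho> i) < k"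
  shows "dominant P (\<lambda>n. pr (\<rho> n))"
proof -
  let ?\<rho> = "\<lambda>i. \<rho> (m + i)"
  have "?\<rho> 0 = \<rho> m" by simp
  moreover have "\<forall>i. step E S (?\<rho> i) (?\<rho> (Suc i))" "\<forall>i>0. pr (?\<rho> i) < k"
    using assms(2-) by auto
  ultimately have "dominant P (\<lambda>n. pr (?\<rho> n))" 
    using S[unfolded secures_def, THEN spec, of ?\<rho>] by blast
  then show ?thesis using dominant_shift[of P "\<lambda>n. pr (\<rho> n)" m] by simp
qed

lemma step_length: "step E S v w \<Longrightarrow> length w = Suc (length v)"
  by (auto simp: step_def)

section \<open>Vertex strategies that recover an earlier vertex of the play\<close>

lemma length_path:
  assumes "\<And>i. i < n \<Longrightarrow> step E S (\<rho> i) (\<rho> (Suc i))" "j \<le> n"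
  shows "length (\<rho> j) = length (\<rho> 0) + j"
  using \<open>j \<le> n\<close>
proof (induction j)
  case (Suc j)
  then show ?case using step_length[OF assms(1)[of j]] by simp
qed simp

text \<open>A vertex strategy must find, from the vertex alone, where the current strategy was
  adopted. Ancestors are suffixes, so the recursion walks back towards \<open>x\<close>.\<close>

fun last_reset :: "(dir list \<Rightarrow> bool) \<Rightarrow> dir list \<Rightarrow> dir list \<Rightarrow> dir list" where
  "last_reset R x [] = []"
| "last_reset R x (d # v) = (if d # v = x \<or> R (d # v) then d # v else last_reset R x v)"

text \<open>The tail is searched first, so the earliest hit after \<open>x\<close> takes precedence;
  \<open>x\<close> itself never counts.\<close>

fun first_hit :: "(dir list \<Rightarrow> bool) \<Rightarrow> dir list \<Rightarrow> dir list \<Rightarrow> dir list option" where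
  "first_hit R x [] = None"
| "first_hit R x (d # v) = (if d # v = x then None else case first_hit R x v of
      Some y \<Rightarrow> Some y | None \<Rightarrow> if R (d # v) then Some (d # v) else None)"

lemma last_reset_self: "last_reset R x x = x"
  by (cases x) auto

lemma first_hit_self: "first_hit R x x = None"
  by (cases x) auto

lemma last_reset_path:
  assumes st: "\<And>i. i < n \<Longrightarrow> step E S (\<rho> i) (\<rho> (Suc i))"
    and m: "m = 0 \<or> R (\<rho> m)" and no: "\<And>i. m < i \<Longrightarrow> i \<le> j \<Longrightarrow> \<not> R (\<rho> i)" and "m \<le> j" "j \<le> n"
  shows "last_reset R (\<rho> 0) (\<rho> j) = \<rho> m"
  using \<open>m \<le> j\<close> no \<open>j \<le> n\<close>
proof (induction j rule: dec_induct)
  case base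
  then show ?case
    using m last_reset_self[of R "\<rho> 0"] by (cases "\<rho> m") auto
next
  case (step j)
  obtain d where d: "\<rho> (Suc j) = d # \<rho> j"
    using st[of j] step.prems by (auto simp: step_def)
  have "\<rho> (Suc j) \<noteq> \<rho> 0"
    using length_path[of n E S \<rho> "Suc j", OF st] step.prems by auto
  moreover have "\<not> R (\<rho> (Suc j))" using step by simp
  ultimately show ?case using d step by simp
qed

lemma first_hit_path:
  assumes st: "\<And>i. i < n \<Longrightarrow> step E S (\<rho> i) (\<rho> (Suc i))"
    and no: "\<And>i. 0 < i \<Longrightarrow> i < m \<Longrightarrow> \<not> R (\<rho> i)" and m: "0 < m" "m \<le> n \<Longrightarrow> R (\<rho> m)" and "j \<le> n"
  shows "first_hit R (\<rho> 0) (\<rho> j) = (if j < m then None else Some (\<rho> m))"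
  using \<open>j \<le> n\<close>
proof (induction j)
  case 0
  then show ?case using m by (simp add: first_hit_self)
next
  case (Suc j)
  obtain d where d: "\<rho> (Suc j) = d # \<rho> j"
    using st[of j] Suc.prems by (auto simp: step_def)
  have ne: "\<rho> (Suc j) \<noteq> \<rho> 0"
    using length_path[of n E S \<rho> "Suc j", OF st] Suc.prems by auto
  consider "Suc j < m" | "Suc j = m" | "m \<le> j" by linarith
  then show ?case
  proof cases
    case 1
    with Suc no[of "Suc j"] ne d show ?thesis by simp
  next
    case 2
    with Suc m ne d show ?thesis by auto
  next
    case 3
    with Suc ne d show ?thesis by simp
  qed
qed

lemma last_before:
  fixes m :: nat
  assumes "Q 0" "0 < m"
  shows "\<exists>m'<m. Q m' \<and> (\<forall>i. m' < i \<and> i < m \<longrightarrow> \<not> Q i)"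
  using \<open>0 < m\<close>
proof (induction m)
  case (Suc m)
  show ?case
  proof (cases "Q m")
    case False
    with \<open>Q 0\<close> have "0 < m" by (cases m) auto
    with Suc.IH obtain m' where "m' < m" "Q m'" "\<forall>i. m' < i \<and> i < m \<longrightarrow> \<not> Q i" by blast
    with False show ?thesis by (metis less_Suc_eq)
  qed (intro exI[of _ m], auto)
qed simp

text \<open>Restart with the strategy of the current vertex at every visit to priority k; a play with
  infinitely many restarts has dominant priority k.\<close>

lemma secures_gfp:
  assumes "P k" and "x \<in> Y" and T: "\<And>y. y \<in> Y \<Longrightarrow> secures P E pr k (select_above pr k X Y) (T y) y"
  defines "S \<equiv> \<lambda>v. T (last_reset (\<lambda>v. k \<le> pr v) x v) v"
  shows "secures P E pr (Suc k) X S x"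
proof -
  let ?reset = "\<lambda>\<rho> m. m = 0 \<or> k \<le> pr (\<rho> m)"
  \<comment> \<open>Until the next reset \<open>last_reset\<close> keeps returning
    \<open>\<rho> m\<close>, so the play obeys the single strategy
    \<open>T (\<rho> m)\<close>.\<close>
  have follow: "step E (T (\<rho> m)) (\<rho> i) (\<rho> (Suc i))"
    if "\<rho> 0 = x" "\<And>i. i < n \<Longrightarrow> step E S (\<rho> i) (\<rho> (Suc i))" "?reset \<rho> m"
      "\<And>j. m < j \<Longrightarrow> j \<le> i \<Longrightarrow> pr (\<rho> j) < k" "m \<le> i" "i < n" for \<rho> m n i
  proof -
    have "last_reset (\<lambda>v. k \<le> pr v) x (\<rho> i) = \<rho> m"
      using last_reset_path[of n E S \<rho> m "\<lambda>v. k \<le> pr v" i] that by (auto simp: not_le)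
    then show ?thesis
      using that(2)[OF \<open>i < n\<close>] by (simp add: step_def S_def)
  qed
  \<comment> \<open>Induction along the resets, strong because the previous one lies at an arbitrary
    earlier time. Index 0 is separate since \<open>x\<close> may have any priority.\<close>
  have inside: "if m = 0 then \<rho> m \<in> Y else \<rho> m \<in> select_above pr k X Y"
    if x0: "\<rho> 0 = x" and st: "\<And>i. i < n \<Longrightarrow> step E S (\<rho> i) (\<rho> (Suc i))"
      and low: "\<And>i. 0 < i \<Longrightarrow> i < n \<Longrightarrow> pr (\<rho> i) < Suc k" and "?reset \<rho> m" "m \<le> n" for \<rho> n m
    using \<open>?reset \<rho> m\<close> \<open>m \<le> n\<close>
  proof (induction m rule: less_induct)
    case (less m)
    show ?case
    proof (cases "m = 0")
      case True
      then show ?thesis using x0 \<open>x \<in> Y\<close> by simp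
    next
      case False
      then obtain m' where m': "m' < m" "?reset \<rho> m'" "\<forall>i. m' < i \<and> i < m \<longrightarrow> \<not> ?reset \<rho> i"
        using last_before[of "?reset \<rho>" m] by auto
      have "\<rho> m' \<in> Y"
        using less.IH[of m'] m' less.prems low[of m'] by (auto simp: select_above_def split: if_splits)
      then have "\<rho> m \<in> select_above pr k X Y"
        using m' less.prems False
        by (intro secures_reach[OF T \<open>m' < m\<close>] follow[OF x0 st]) (auto simp: not_le)
      with False show ?thesis by simp
    qed
  qed
  show ?thesis
  proof (rule securesI)
    fix \<rho> n
    assume *: "\<rho> 0 = x" "0 < n" "\<And>i. i < n \<Longrightarrow> step E S (\<rho> i) (\<rho> (Suc i))"
      "\<And>i. 0 < i \<Longrightarrow> i < n \<Longrightarrow> pr (\<rho> i) < Suc k" "Suc k \<le> pr (\<rho> n)"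
    have "\<rho> n \<in> select_above pr k X Y"
      using inside[OF *(1,3,4), of n n] *(2,5) by auto
    then show "\<rho> n \<in> X" using *(5) by (simp add: select_above_def)
  next
    fix \<rho>
    assume *: "\<rho> 0 = x" "\<And>i. step E S (\<rho> i) (\<rho> (Suc i))" "\<And>i. 0 < i \<Longrightarrow> pr (\<rho> i) < Suc k"
    show "dominant P (\<lambda>n. pr (\<rho> n))"
    proof (cases "\<exists>\<^sub>\<infinity>n. pr (\<rho> n) = k")
      case True
      moreover have "\<forall>\<^sub>\<infinity>n. pr (\<rho> n) \<le> k"
        unfolding MOST_nat using *(3) less_Suc_eq_le by blast
      ultimately show ?thesis using \<open>P k\<close> by (auto simp: dominant_def)
    next
      case False
      \<comment> \<open>Priority \<open>k\<close> is absent after \<open>b\<close>, so all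
        priorities after the last reset \<open>m\<close> up to time \<open>b\<close> are below
        \<open>k\<close> and \<open>T (\<rho> m)\<close> wins the rest.\<close>
      then obtain b where b: "\<forall>n>b. pr (\<rho> n) \<noteq> k" by (auto simp: INFM_nat)
      obtain m where m: "m < Suc b" "?reset \<rho> m" "\<forall>i. m < i \<and> i < Suc b \<longrightarrow> \<not> ?reset \<rho> i"
        using last_before[of "?reset \<rho>" "Suc b"] by auto
      have no: "pr (\<rho> i) < k" if "m < i" for i
        using m(3) b *(3)[of i] that
        by (cases "i < Suc b") (auto simp: not_le less_Suc_eq)
      have "\<rho> m \<in> Y"
        using inside[OF *(1,2,3), of m m] m(2) *(3)[of m] \<open>x \<in> Y\<close> *(1)
        by (cases "m = 0") (auto simp: select_above_def)
      moreover have "step E (T (\<rho> m)) (\<rho> i) (\<rho> (Suc i))" if "m \<le> i" for i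
        by (rule follow[of \<rho> "Suc i" m i, OF *(1) *(2) m(2) no]) (use that in auto)
      ultimately show ?thesis
        using no by (intro secures_forever[OF T, of \<rho> m])
    qed
  qed
qed

text \<open>Here a single switch suffices: the set of vertices that can be secured for k + 1 is a prefixed
  point.\<close>

lemma secures_lfp:
  assumes S0: "secures P E pr k (select_above pr k X U) S0 x"
    and T: "\<And>u. u \<in> U \<Longrightarrow> secures P E pr (Suc k) X (T u) u"
  defines "S \<equiv> \<lambda>v. case first_hit (\<lambda>v. k \<le> pr v) x v of None \<Rightarrow> S0 v | Some u \<Rightarrow> T u v"
  shows "secures P E pr (Suc k) X S x"
proof -
  let ?R = "\<lambda>v. k \<le> pr v"
  have before: "step E S0 (\<rho> i) (\<rho> (Suc i))"
    if "\<rho> 0 = x" "\<And>i. i < n \<Longrightarrow> step E S (\<rho> i) (\<rho> (Suc i))"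
      "\<And>j. 0 < j \<Longrightarrow> j < n \<Longrightarrow> pr (\<rho> j) < k" "i < n" for \<rho> n i
  proof -
    have "first_hit ?R x (\<rho> i) = None"
      \<comment> \<open>The hit time \<open>Suc i\<close> lies beyond the path of length
        \<open>i\<close>, which expresses that no hit has occurred yet.\<close>
      using first_hit_path[of i E S \<rho> "Suc i" ?R i] that by (simp add: not_le)
    then show ?thesis using that(2)[OF \<open>i < n\<close>] by (simp add: step_def S_def)
  qed
  have after: "step E (T (\<rho> m)) (\<rho> i) (\<rho> (Suc i))"
    if "\<rho> 0 = x" "\<And>i. i < n \<Longrightarrow> step E S (\<rho> i) (\<rho> (Suc i))"
      "0 < m" "k \<le> pr (\<rho> m)" "\<And>j. 0 < j \<Longrightarrow> j < m \<Longrightarrow> pr (\<rho> j) < k" "m \<le> i" "i < n" for \<rho> n m i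
  proof -
    have "first_hit ?R x (\<rho> i) = Some (\<rho> m)"
      using first_hit_path[of n E S \<rho> m ?R i] that by (simp add: not_le)
    then show ?thesis using that(2)[OF \<open>i < n\<close>] by (simp add: step_def S_def)
  qed
  have hit: "\<rho> m \<in> select_above pr k X U"
    if "\<rho> 0 = x" "\<And>i. i < m \<Longrightarrow> step E S (\<rho> i) (\<rho> (Suc i))"
      "0 < m" "k \<le> pr (\<rho> m)" "\<And>j. 0 < j \<Longrightarrow> j < m \<Longrightarrow> pr (\<rho> j) < k" for \<rho> m
    using that(3-) before[OF that(1,2,5)]
    by (intro secures_reach[of P E pr k _ S0 \<rho> 0]) (auto simp: S0[folded that(1)])
  have first: "\<exists>m. 0 < m \<and> m \<le> n \<and> k \<le> pr (\<rho> m) \<and> (\<forall>j. 0 < j \<and> j < m \<longrightarrow> pr (\<rho> j) < k)"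
    if "0 < n" "k \<le> pr (\<rho> n)" for \<rho> :: "nat \<Rightarrow> dir list" and n
    using that exists_least_iff[of "\<lambda>n. 0 < n \<and> k \<le> pr (\<rho> n)"]
    by (metis leI not_le)
  show ?thesis
  proof (rule securesI)
    fix \<rho> n
    assume *: "\<rho> 0 = x" "0 < n" "\<And>i. i < n \<Longrightarrow> step E S (\<rho> i) (\<rho> (Suc i))"
      "\<And>i. 0 < i \<Longrightarrow> i < n \<Longrightarrow> pr (\<rho> i) < Suc k" "Suc k \<le> pr (\<rho> n)"
    obtain m where m: "0 < m" "m \<le> n" "k \<le> pr (\<rho> m)" "\<And>j. 0 < j \<Longrightarrow> j < m \<Longrightarrow> pr (\<rho> j) < k"
      using first[of n \<rho>] * by auto
    have mU: "\<rho> m \<in> select_above pr k X U"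
      using m * by (intro hit) auto
    show "\<rho> n \<in> X"
    \<comment> \<open>If the first hit is the end, its priority exceeds \<open>k\<close> and
      \<open>X\<close> decides; otherwise its priority is exactly \<open>k\<close>, so it lies in
      \<open>U\<close> and \<open>T\<close> takes over.\<close>
    proof (cases "m = n")
      case True
      with mU *(5) show ?thesis by (simp add: select_above_def)
    next
      case False
      with m have "m < n" by simp
      then have "\<rho> m \<in> U" using mU m *(4)[of m] by (simp add: select_above_def)
      moreover have "step E (T (\<rho> m)) (\<rho> i) (\<rho> (Suc i))" if "m \<le> i" "i < n" for i
        by (rule after[OF *(1,3) m(1,3,4) that])
      ultimately show ?thesis
        using T \<open>m < n\<close> *(4,5) by (intro secures_reach[of P E pr "Suc k" X "T (\<rho> m)" \<rho> m n]) auto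
    qed
  next
    fix \<rho>
    assume *: "\<rho> 0 = x" "\<And>i. step E S (\<rho> i) (\<rho> (Suc i))" "\<And>i. 0 < i \<Longrightarrow> pr (\<rho> i) < Suc k"
    show "dominant P (\<lambda>n. pr (\<rho> n))"
    proof (cases "\<exists>n>0. k \<le> pr (\<rho> n)")
      case True
      then obtain m where m: "0 < m" "k \<le> pr (\<rho> m)" "\<And>j. 0 < j \<Longrightarrow> j < m \<Longrightarrow> pr (\<rho> j) < k"
        using first[of _ \<rho>] by blast
      have "\<rho> m \<in> select_above pr k X U"
        using m * by (intro hit) auto
      then have "\<rho> m \<in> U" using m *(3)[of m] by (simp add: select_above_def)
      moreover have "step E (T (\<rho> m)) (\<rho> i) (\<rho> (Suc i))" if "m \<le> i" for i
        by (rule after[of \<rho> "Suc i" m i, OF *(1,2) m that]) auto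
      ultimately show ?thesis
        using T *(3) by (intro secures_forever[of P E pr "Suc k" X "T (\<rho> m)" \<rho> m]) auto
    next
      case False
      then have no: "pr (\<rho> i) < k" if "0 < i" for i
        using that by (meson not_le)
      have "step E S0 (\<rho> i) (\<rho> (Suc i))" for i
        by (rule before[of \<rho> "Suc i" i, OF *(1,2) no]) auto
      then show ?thesis
        using no S0[folded *(1)] by (intro secures_forever[of P E pr k _ S0 \<rho> 0])
    qed
  qed
qed

text \<open>A greatest fixpoint is postfixed, so the strategies of all its vertices can be glued
  together. A least fixpoint lies in every prefixed set, in particular in the set of securable
  vertices.\<close>

lemma region_secures:
  "x \<in> region P E pr k X \<Longrightarrow> \<exists>S. secures P E pr k X S x"
proof (induction k arbitrary: x X)
  case 0
  let ?S = "\<lambda>v. if DL # v \<in> X then DL else DR"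
  have "secures P E pr 0 X ?S x"
  proof (rule securesI)
    fix \<rho> n
    assume *: "\<rho> 0 = x" "0 < n" "\<And>i. i < n \<Longrightarrow> step E ?S (\<rho> i) (\<rho> (Suc i))"
      "\<And>i. 0 < i \<Longrightarrow> i < n \<Longrightarrow> pr (\<rho> i) < 0"
    \<comment> \<open>Every priority is at least 0, so the game for 0 stops after one step; for the
      same reason the clause on infinite plays is vacuous.\<close>
    have "n = 1" using *(2) *(4)[of 1] by (cases "n = 1") auto
    then show "\<rho> n \<in> X"
      using *(1) *(3)[of 0] 0 by (auto simp: step_def cpre_def ex_dir split: if_splits)
  qed auto
  then show ?case by (intro exI[of _ ?S])
next
  case (Suc k)
  let ?F = "\<lambda>Y. region P E pr k (select_above pr k X Y)"
  show ?case
  proof (cases "P k")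
    case True
    let ?Y = "gfp ?F"
    have "\<exists>T. secures P E pr k (select_above pr k X ?Y) T y" if "y \<in> ?Y" for y
    proof (rule Suc.IH)
      show "y \<in> ?F ?Y" using that gfp_unfold[OF mono_region_select_above] by blast
    qed
    then obtain T where T: "\<And>y. y \<in> ?Y \<Longrightarrow> secures P E pr k (select_above pr k X ?Y) (T y) y" by metis
    from True Suc.prems have "x \<in> ?Y" by simp
    from secures_gfp[where P = P and k = k, OF True this T] show ?thesis by blast
  next
    case False
    let ?U = "{x. \<exists>S. secures P E pr (Suc k) X S x}"
    obtain T where T: "\<And>u. u \<in> ?U \<Longrightarrow> secures P E pr (Suc k) X (T u) u"
      using bchoice[of ?U "\<lambda>u S. secures P E pr (Suc k) X S u"] by auto
    have "?F ?U \<subseteq> ?U"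
    proof
      fix y assume "y \<in> ?F ?U"
      then obtain S0 where "secures P E pr k (select_above pr k X ?U) S0 y" using Suc.IH by blast
      from secures_lfp[OF this T] show "y \<in> ?U" by blast
    qed
    then have "lfp ?F \<subseteq> ?U" by (rule lfp_lowerbound)
    then show ?thesis using False Suc.prems by auto
  qed
qed

section \<open>The region decides the game\<close>

lemma secures_top_wins:
  assumes "secures P E pr K X S []" and "\<And>v. pr v < K"
    and "\<rho> 0 = []" "\<And>n. step E S (\<rho> n) (\<rho> (Suc n))"
  shows "dominant P (\<lambda>n. pr (\<rho> n))"
  using assms unfolding secures_def by blast

text \<open>If the root is outside the region, \<open>Compl_region\<close> puts it into the
  opponent's region, whose strategy refutes every \<open>S\<close>.\<close>

lemma ex_wins_iff_region:
  assumes bound: "\<And>v. pr v < K"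
  shows "ex_wins P E pr \<longleftrightarrow> [] \<in> region P E pr K {}"
proof
  assume "[] \<in> region P E pr K {}"
  then obtain S where "secures P E pr K {} S []" using region_secures by blast
  from secures_top_wins[OF this bound] show "ex_wins P E pr"
    unfolding ex_wins_def by blast
next
  assume "ex_wins P E pr"
  then obtain S where S: "\<And>\<rho>. \<rho> 0 = [] \<Longrightarrow> (\<And>n. step E S (\<rho> n) (\<rho> (Suc n))) \<Longrightarrow>
      dominant P (\<lambda>n. pr (\<rho> n))"
    unfolding ex_wins_def by blast
  show "[] \<in> region P E pr K {}"
  proof (rule ccontr)
    assume "[] \<notin> region P E pr K {}"
    then have "[] \<in> region (\<lambda>p. \<not> P p) (- E) pr K (- {})"
      using Compl_region by blast
    then obtain S' where S': "secures (\<lambda>p. \<not> P p) (- E) pr K (- {}) S' []"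
      using region_secures by blast
    \<comment> \<open>The play of \<open>S\<close> against \<open>S'\<close> would be dominant for
      \<open>P\<close> and for its negation.\<close>
    define \<rho> where "\<rho> = rec_nat [] (\<lambda>_ v. (if v \<in> E then S v else S' v) # v)"
    have \<rho>: "\<rho> 0 = []" "\<rho> (Suc n) = (if \<rho> n \<in> E then S (\<rho> n) else S' (\<rho> n)) # \<rho> n" for n
      by (simp_all add: \<rho>_def)
    then have "step E S (\<rho> n) (\<rho> (Suc n))" "step (- E) S' (\<rho> n) (\<rho> (Suc n))" for n
      by (auto simp: step_def)
    then show False
      using S[of \<rho>] secures_top_wins[OF S' bound, of \<rho>] \<rho>(1) dominant_contradictory by blast
  qed
qed

section \<open>The acceptance game\<close>

fun ex_trans :: "'q trans \<Rightarrow> bool" where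
  "ex_trans (Or _ _) = True"
| "ex_trans (And _ _) = False"

fun target :: "'q trans \<Rightarrow> dir \<Rightarrow> 'q" where
  "target (Or a b) d = (case d of DL \<Rightarrow> a | DR \<Rightarrow> b)"
| "target (And a b) d = (case d of DL \<Rightarrow> a | DR \<Rightarrow> b)"

text \<open>Game vertices carry the last move first, tree addresses the first move first; hence
  \<open>rev v\<close>.\<close>

primrec state :: "'q \<Rightarrow> ('q \<Rightarrow> 's \<Rightarrow> 'q trans) \<Rightarrow> (dir list \<Rightarrow> 's) \<Rightarrow> dir list \<Rightarrow> 'q" where
  "state q0 \<delta> t [] = q0"
| "state q0 \<delta> t (d # v) = target (\<delta> (state q0 \<delta> t v) (t (rev v))) d"

definition ex_nodes :: "'q \<Rightarrow> ('q \<Rightarrow> 's \<Rightarrow> 'q trans) \<Rightarrow> (dir list \<Rightarrow> 's) \<Rightarrow> dir list set" where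
  "ex_nodes q0 \<delta> t = {v. ex_trans (\<delta> (state q0 \<delta> t v) (t (rev v)))}"

definition tree_wins :: "'q \<Rightarrow> ('q \<Rightarrow> 's \<Rightarrow> 'q trans) \<Rightarrow> ('q \<Rightarrow> nat) \<Rightarrow> (dir list \<Rightarrow> 's) \<Rightarrow> bool" where
  "tree_wins q0 \<delta> \<pi> t = ex_wins even (ex_nodes q0 \<delta> t) (\<lambda>v. \<pi> (state q0 \<delta> t v))"

definition pos :: "'q \<Rightarrow> ('q \<Rightarrow> 's \<Rightarrow> 'q trans) \<Rightarrow> (dir list \<Rightarrow> 's) \<Rightarrow> dir list \<Rightarrow> 'q pos" where
  "pos q0 \<delta> t v = (rev v, state q0 \<delta> t v)"

primrec history :: "'q \<Rightarrow> ('q \<Rightarrow> 's \<Rightarrow> 'q trans) \<Rightarrow> (dir list \<Rightarrow> 's) \<Rightarrow> dir list \<Rightarrow> 'q pos list" where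
  "history q0 \<delta> t [] = [pos q0 \<delta> t []]"
| "history q0 \<delta> t (d # v) = history q0 \<delta> t v @ [pos q0 \<delta> t (d # v)]"

lemma last_history: "last (history q0 \<delta> t v) = pos q0 \<delta> t v"
  by (cases v) auto

lemma length_history: "length (history q0 \<delta> t v) = Suc (length v)"
  by (induction v) auto

lemma ga_move_pos: "ga_move \<delta> t (pos q0 \<delta> t v) d = pos q0 \<delta> t (d # v)"
  by (simp add: ga_move_def pos_def split: trans.split dir.split)

lemma ga_owner_ex_pos: "ga_owner_ex \<delta> t (pos q0 \<delta> t v) \<longleftrightarrow> v \<in> ex_nodes q0 \<delta> t"
  by (simp add: ga_owner_ex_def pos_def ex_nodes_def split: trans.split)

lemma ga_hist_history:
  assumes "\<rho> 0 = []"
    and "\<And>n. \<rho> (Suc n) = (if \<rho> n \<in> ex_nodes q0 \<delta> t then \<sigma> (history q0 \<delta> t (\<rho> n))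
      else \<tau> (history q0 \<delta> t (\<rho> n))) # \<rho> n"
  shows "ga_hist q0 \<delta> t \<sigma> \<tau> n = history q0 \<delta> t (\<rho> n)"
  by (induction n)
    (simp_all add: assms Let_def last_history ga_owner_ex_pos ga_move_pos, simp add: pos_def)

text \<open>A vertex and the history leading to it determine each other, so strategies on histories
  and on vertices translate both ways.\<close>

lemma ga_accepts_iff_tree_wins:
  fixes q0 :: "'q::finite"
  shows "ga_accepts q0 \<delta> \<pi> t \<longleftrightarrow> tree_wins q0 \<delta> \<pi> t"
proof
  let ?E = "ex_nodes q0 \<delta> t" and ?h = "history q0 \<delta> t"
  assume "ga_accepts q0 \<delta> \<pi> t"
  then obtain \<sigma> where \<sigma>: "\<And>\<tau>. parity_accepts \<pi> (\<lambda>n. snd (last (ga_hist q0 \<delta> t \<sigma> \<tau> n)))"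
    by (auto simp: ga_accepts_def)
  have "dominant even (\<lambda>n. \<pi> (state q0 \<delta> t (\<rho> n)))"
    if 0: "\<rho> 0 = []" and st: "\<And>n. step ?E (\<lambda>v. \<sigma> (?h v)) (\<rho> n) (\<rho> (Suc n))" for \<rho>
  proof -
    have len: "length (\<rho> n) = n" for n
      using length_path[of n ?E _ \<rho> n, OF st] 0 by simp
    \<comment> \<open>The opponent replays \<open>\<rho>\<close>: the history at time
      \<open>n\<close> has length \<open>Suc n\<close>, and the head of
      \<open>\<rho> (Suc n)\<close> is the direction just taken.\<close>
    have "ga_hist q0 \<delta> t \<sigma> (\<lambda>h. hd (\<rho> (length h))) n = ?h (\<rho> n)" for n
    proof (rule ga_hist_history[of \<rho>, OF 0])
      show "\<rho> (Suc n) = (if \<rho> n \<in> ?E then \<sigma> (?h (\<rho> n)) else hd (\<rho> (length (?h (\<rho> n))))) # \<rho> n" for n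
        using st[of n] by (auto simp: step_def length_history len)
    qed
    then show ?thesis
      using \<sigma>[of "\<lambda>h. hd (\<rho> (length h))"]
      by (simp add: last_history pos_def parity_accepts_iff_dominant)
  qed
  then show "tree_wins q0 \<delta> \<pi> t"
    unfolding tree_wins_def ex_wins_def by blast
next
  let ?E = "ex_nodes q0 \<delta> t" and ?h = "history q0 \<delta> t"
  assume "tree_wins q0 \<delta> \<pi> t"
  then obtain S where S: "\<And>\<rho>. \<rho> 0 = [] \<Longrightarrow> (\<And>n. step ?E S (\<rho> n) (\<rho> (Suc n))) \<Longrightarrow>
      dominant even (\<lambda>n. \<pi> (state q0 \<delta> t (\<rho> n)))"
    unfolding tree_wins_def ex_wins_def by blast
  define \<sigma> :: "'q pos list \<Rightarrow> dir" where "\<sigma> h = S (rev (fst (last h)))" for h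
  have \<sigma>: "\<sigma> (?h v) = S v" for v by (simp add: \<sigma>_def last_history pos_def)
  have "parity_accepts \<pi> (\<lambda>n. snd (last (ga_hist q0 \<delta> t \<sigma> \<tau> n)))" for \<tau>
  proof -
    define \<rho> where "\<rho> = rec_nat [] (\<lambda>_ v. (if v \<in> ?E then \<sigma> (?h v) else \<tau> (?h v)) # v)"
    have \<rho>: "\<rho> 0 = []" "\<rho> (Suc n) = (if \<rho> n \<in> ?E then \<sigma> (?h (\<rho> n)) else \<tau> (?h (\<rho> n))) # \<rho> n" for n
      by (simp_all add: \<rho>_def)
    have "dominant even (\<lambda>n. \<pi> (state q0 \<delta> t (\<rho> n)))"
      by (rule S) (auto simp: \<rho> step_def \<sigma>)
    then show ?thesis
      by (simp add: ga_hist_history[of \<rho>, OF \<rho>] last_history pos_def parity_accepts_iff_dominant)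
  qed
  then show "ga_accepts q0 \<delta> \<pi> t"
    unfolding ga_accepts_def by blast
qed

section \<open>Measurability of the language\<close>

lemma measurable_count_space_binop:
  fixes f :: "'a \<Rightarrow> 'b::countable" and g :: "'a \<Rightarrow> 'c"
  assumes "f \<in> M \<rightarrow>\<^sub>M count_space UNIV" "g \<in> M \<rightarrow>\<^sub>M count_space UNIV"
  shows "(\<lambda>x. F (f x) (g x)) \<in> M \<rightarrow>\<^sub>M count_space UNIV"
  by (rule measurable_compose_countable[OF measurable_compose[OF assms(2)] assms(1)]) simp

lemma prob_space_coin_measure: "prob_space coin_measure"
  unfolding coin_measure_def by (intro prob_space_PiM prob_space_measure_pmf)

lemma measurable_component_coin:
  "(\<lambda>t. t x) \<in> coin_measure \<rightarrow>\<^sub>M count_space UNIV"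
proof -
  have "(\<lambda>t. t x) \<in> coin_measure \<rightarrow>\<^sub>M measure_pmf (pmf_of_set UNIV)"
    unfolding coin_measure_def by (rule measurable_component_singleton) simp
  then show ?thesis by (simp cong: measurable_cong_sets)
qed

lemma measurable_state:
  fixes q0 :: "'q::finite"
  shows "(\<lambda>t. state q0 \<delta> t v) \<in> coin_measure \<rightarrow>\<^sub>M count_space UNIV"
proof (induction v)
  case (Cons d v)
  from measurable_count_space_binop[OF this measurable_component_coin[of "rev v"],
      of "\<lambda>q a. target (\<delta> q a) d"]
  show ?case by simp
qed simp

lemma ga_lang_measurable:
  fixes q0 :: "'q::finite" and \<delta> :: "'q \<Rightarrow> 's::finite \<Rightarrow> 'q trans"
  shows "ga_lang q0 \<delta> \<pi> \<in> sets (completion (coin_measure :: (dir list \<Rightarrow> 's) measure))"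
proof -
  let ?M = "completion (coin_measure :: (dir list \<Rightarrow> 's) measure)"
  interpret prob_space ?M
    using prob_space.prob_space_completion[OF prob_space_coin_measure] .
  let ?E = "ex_nodes q0 \<delta>" and ?pr = "\<lambda>t v. \<pi> (state q0 \<delta> t v)"
  \<comment> \<open>Finitely many states bound the priorities, so one level serves all
    trees.\<close>
  define K where "K = Suc (Max (range \<pi>))"
  have bound: "\<pi> q < K" for q unfolding K_def by (simp add: less_Suc_eq_le)
  have space: "space ?M = UNIV" by (simp add: coin_measure_def space_PiM)
  have "{t \<in> space ?M. [] \<in> region even (?E t) (?pr t) K {}} \<in> sets ?M"
  proof (rule region_measurable)
    fix v :: "dir list" and k
    have st: "(\<lambda>t. state q0 \<delta> t v) \<in> ?M \<rightarrow>\<^sub>M count_space UNIV"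
      and lt: "(\<lambda>t. t (rev v)) \<in> ?M \<rightarrow>\<^sub>M count_space UNIV"
      by (intro measurable_completion measurable_state measurable_component_coin)+
    show "{t \<in> space ?M. v \<in> ?E t} \<in> sets ?M"
      using measurable_count_space_binop[OF st lt, of "\<lambda>q a. ex_trans (\<delta> q a)"]
      by (simp add: pred_def ex_nodes_def)
    show "{t \<in> space ?M. k < ?pr t v} \<in> sets ?M"
      using measurable_count_space_binop[OF st lt, of "\<lambda>q a. k < \<pi> q"]
      by (simp add: pred_def)
  qed (simp_all add: finite_measure_axioms completion.complete_measure_axioms)
  moreover have "ga_lang q0 \<delta> \<pi> = {t \<in> space ?M. [] \<in> region even (?E t) (?pr t) K {}}"
    unfolding ga_lang_def ga_accepts_iff_tree_wins tree_wins_def space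
    by (simp add: ex_wins_iff_region[OF bound])
  ultimately show ?thesis by simp
qed

section \<open>Cylinders of the coin measure\<close>

lemma finite_length_less: "finite {v :: dir list. length v < n}"
  by (rule finite_subset[OF _ finite_lists_length_le[of UNIV n]]) auto

lemma sets_coin_measure:
  "sets coin_measure = sigma_sets UNIV {{t. t x \<in> A} |x (A :: 's::finite set). True}"
  by (simp add: coin_measure_def sets_PiM_single)

lemma cylinder_sets_coin:
  "{t. \<forall>x. length x < n \<longrightarrow> t x = a x} \<in> sets (coin_measure :: (dir list \<Rightarrow> 's::finite) measure)"
proof -
  have "{t \<in> space (coin_measure :: (dir list \<Rightarrow> 's) measure).
      \<forall>x\<in>{x. length x < n}. t x = a x} \<in> sets coin_measure"
  proof (rule sets.sets_Collect_finite_All[OF _ finite_length_less])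
    fix x
    show "{t \<in> space (coin_measure :: (dir list \<Rightarrow> 's) measure). t x = a x} \<in> sets coin_measure"
      using measurable_sets[OF measurable_component_coin[of x], of "{a x}"]
      by (simp add: vimage_def Int_def conj_commute)
  qed
  then show ?thesis by (simp add: coin_measure_def space_PiM)
qed

lemma emeasure_coin_cylinder:
  "emeasure coin_measure {t. \<forall>x. length x < n \<longrightarrow> t x = (a x :: 's::finite)} =
    ennreal (1 / real CARD('s)) ^ card {x :: dir list. length x < n}"
proof -
  interpret PP: product_prob_space "\<lambda>_. measure_pmf (pmf_of_set (UNIV :: 's set))" "UNIV :: dir list set"
    by unfold_locales
  let ?D = "{x :: dir list. length x < n}"
  have "{t. \<forall>x. length x < n \<longrightarrow> t x = a x} = {t \<in> space coin_measure. \<forall>x\<in>?D. t x \<in> {a x}}"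
    by (simp add: coin_measure_def space_PiM)
  also have "emeasure coin_measure \<dots> = (\<Prod>x\<in>?D. emeasure (measure_pmf (pmf_of_set UNIV)) {a x})"
    unfolding coin_measure_def by (rule PP.emeasure_PiM_Collect) (use finite_length_less in auto)
  also have "\<dots> = (\<Prod>x\<in>?D. ennreal (1 / real CARD('s)))"
    by (simp add: emeasure_pmf_single)
  finally show ?thesis by simp
qed

text \<open>Cylinders fixing all letters up to a given depth are nested or disjoint and, with the
  empty set, form an intersection-stable generator. Full depth is chosen because the states reached
  are then determined, as \<open>tree_of_agrees_iff\<close> requires.\<close>

lemma coin_measure_eqI:
  fixes m :: "(dir list \<Rightarrow> 's::finite) measure"
  assumes sets: "sets m = sets coin_measure"
    and eq: "\<And>n a. emeasure m {t. \<forall>x. length x < n \<longrightarrow> t x = a x} =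
      emeasure coin_measure {t. \<forall>x. length x < n \<longrightarrow> t x = a x}"
  shows "m = coin_measure"
proof -
  define cyl :: "nat \<Rightarrow> (dir list \<Rightarrow> 's) \<Rightarrow> (dir list \<Rightarrow> 's) set"
    where "cyl n a = {t. \<forall>x. length x < n \<longrightarrow> t x = a x}" for n a
  let ?E = "insert {} {cyl n a |n a. True}"
  have cyl_Int: "cyl n a \<inter> cyl k b \<in> ?E" if "n \<le> k" for n k a b
  proof (cases "\<forall>x. length x < n \<longrightarrow> a x = b x")
    case True
    with that have "cyl n a \<inter> cyl k b = cyl k b" by (auto simp: cyl_def)
    then show ?thesis by blast
  next
    case False
    with that have "cyl n a \<inter> cyl k b = {}" by (fastforce simp: cyl_def)
    then show ?thesis by blast
  qed
  have "A \<inter> B \<in> ?E" if "A \<in> ?E" "B \<in> ?E" for A B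
  proof (cases "A = {} \<or> B = {}")
    case False
    with that obtain n a k b where AB: "A = cyl n a" "B = cyl k b" by blast
    show ?thesis
    proof (cases "n \<le> k")
      case True
      from cyl_Int[OF this] AB show ?thesis by simp
    next
      case False
      then have "cyl k b \<inter> cyl n a \<in> ?E" by (intro cyl_Int) simp
      with AB show ?thesis by (simp add: Int_commute)
    qed
  qed auto
  then have stable: "Int_stable ?E" unfolding Int_stable_def by blast
  have fin: "finite {cyl n a |a. True}" for n
  proof (rule finite_subset)
    show "{cyl n a |a. True} \<subseteq> cyl n ` PiE {x. length x < n} (\<lambda>_. UNIV)"
    proof
      fix C assume "C \<in> {cyl n a |a. True}"
      then obtain a where "C = cyl n a" by blast
      then have "C = cyl n (restrict a {x. length x < n})" by (simp add: cyl_def)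
      then show "C \<in> cyl n ` PiE {x. length x < n} (\<lambda>_. UNIV)" by auto
    qed
    show "finite (cyl n ` PiE {x. length x < n} (\<lambda>_. UNIV))"
      by (intro finite_imageI finite_PiE finite_length_less) simp
  qed
  have gen: "sets (coin_measure :: (dir list \<Rightarrow> 's) measure) = sigma_sets UNIV ?E"
    unfolding sets_coin_measure
  proof (rule sigma_sets_eqI)
    fix S assume "S \<in> {{t. t x \<in> A} |(x :: dir list) (A :: 's set). True}"
    then obtain x A where S: "S = {t. t x \<in> A}" by blast
    \<comment> \<open>Depth \<open>Suc (length x)\<close> just suffices to fix the letter at
      \<open>x\<close>.\<close>
    let ?C = "{cyl (Suc (length x)) a |a. a x \<in> A}"
    have "S = \<Union> ?C" by (auto simp: S cyl_def)
    moreover have "\<Union> ?C \<in> sigma_sets UNIV ?E"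
    proof (rule sigma_sets_UNION)
      show "countable ?C"
        by (rule countable_finite, rule finite_subset[OF _ fin[of "Suc (length x)"]]) blast
    qed blast
    ultimately show "S \<in> sigma_sets UNIV ?E" by simp
  next
    fix S assume "S \<in> ?E"
    then show "S \<in> sigma_sets UNIV {{t. t x \<in> A} |(x :: dir list) (A :: 's set). True}"
      unfolding sets_coin_measure[symmetric] by (auto simp: cyl_def cylinder_sets_coin)
  qed
  have UNIV_cyl: "cyl 0 a = UNIV" for a by (simp add: cyl_def)
  show ?thesis
  proof (rule measure_eqI_generator_eq_countable[OF stable, where A = "{UNIV}" and \<Omega> = UNIV])
    show "emeasure m X = emeasure coin_measure X" if "X \<in> ?E" for X
      using that eq by (auto simp: cyl_def)
    show "{UNIV} \<subseteq> ?E" using UNIV_cyl by blast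
    have "emeasure m UNIV = emeasure (coin_measure :: (dir list \<Rightarrow> 's) measure) UNIV"
      using eq[of 0] by simp
    also have "\<dots> = 1"
      using prob_space.emeasure_space_1[OF prob_space_coin_measure]
      by (simp add: coin_measure_def space_PiM)
    finally show "emeasure m a \<noteq> \<infinity>" if "a \<in> {UNIV}" for a using that by simp
  qed (use sets gen in auto)
qed

section \<open>The branching play of a tree\<close>

text \<open>The vertex of the branching play reached by following the directions v in the tree t; it is
  labelled by a probabilistic state, and the mid vertex is its only child.\<close>

primrec vertex :: "'q \<Rightarrow> ('q \<Rightarrow> 's \<Rightarrow> 'q trans) \<Rightarrow> (dir list \<Rightarrow> 's) \<Rightarrow> dir list \<Rightarrow> ('q + 'q \<times> 's) list" where
  "vertex q0 \<delta> t [] = []"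
| "vertex q0 \<delta> t (d # v) = vertex q0 \<delta> t v @
     [Inr (state q0 \<delta> t v, t (rev v)), Inl (state q0 \<delta> t (d # v))]"

definition mid_vertex :: "'q \<Rightarrow> ('q \<Rightarrow> 's \<Rightarrow> 'q trans) \<Rightarrow> (dir list \<Rightarrow> 's) \<Rightarrow> dir list \<Rightarrow> ('q + 'q \<times> 's) list" where
  "mid_vertex q0 \<delta> t v = vertex q0 \<delta> t v @ [Inr (state q0 \<delta> t v, t (rev v))]"

lemma vertex_Cons: "vertex q0 \<delta> t (d # v) = mid_vertex q0 \<delta> t v @ [Inl (state q0 \<delta> t (d # v))]"
  by (simp add: mid_vertex_def)

lemma length_vertex: "length (vertex q0 \<delta> t v) = 2 * length v"
  by (induction v) auto

lemma lbl_vertex: "lbl (Inl q0) (vertex q0 \<delta> t v) = Inl (state q0 \<delta> t v)"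
  by (cases v) (auto simp: lbl_def)

lemma lbl_mid_vertex: "lbl (Inl q0) (mid_vertex q0 \<delta> t v) = Inr (state q0 \<delta> t v, t (rev v))"
  by (simp add: lbl_def mid_vertex_def)

lemma vertex_cong:
  assumes "\<And>x. length x < length v \<Longrightarrow> t x = t' x"
  shows "state q0 \<delta> t v = state q0 \<delta> t' v" "vertex q0 \<delta> t v = vertex q0 \<delta> t' v"
  using assms by (induction v) auto

section \<open>Consequences of distinct successor states\<close>

locale distinct_targets =
  fixes q0 :: "'q::finite" and \<delta> :: "'q \<Rightarrow> 's::finite \<Rightarrow> 'q trans" and \<pi> :: "'q \<Rightarrow> nat"
  assumes distinct_succ: "\<And>q a qL qR. \<delta> q a = Or qL qR \<or> \<delta> q a = And qL qR \<Longrightarrow> qL \<noteq> qR"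
begin

abbreviation "M \<equiv> ga_mbp \<delta> \<pi>"

lemma target_eq_iff: "target (\<delta> q a) d = target (\<delta> q a) d' \<longleftrightarrow> d = d'"
proof (cases "\<delta> q a")
  case (Or qL qR)
  with distinct_succ[of q a qL qR] show ?thesis by (cases d; cases d') auto
next
  case (And qL qR)
  with distinct_succ[of q a qL qR] show ?thesis by (cases d; cases d') auto
qed

text \<open>A branching vertex has one child per successor state, so equal targets would merge both
  directions into one vertex with one random choice. Distinct targets exclude this.\<close>

lemma inj_vertex: "inj (vertex q0 \<delta> t)"
proof (rule injI)
  fix v v' assume "vertex q0 \<delta> t v = vertex q0 \<delta> t v'"
  then show "v = v'"
  proof (induction v arbitrary: v')
    case Nil
    then show ?case by (cases v') auto
  next
    case (Cons d v)
    then obtain d' u where v': "v' = d' # u" by (cases v') auto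
    with Cons have "v = u" by simp
    with Cons.prems v' show ?case by (auto simp: target_eq_iff)
  qed
qed

lemma succ_Inr: "succ M (Inr (q, a)) = range (\<lambda>d. Inl (target (\<delta> q a) d))"
proof -
  have "(UNIV :: dir set) = {DL, DR}" by (auto intro: dir.exhaust)
  then have "range f = {f DL, f DR}" for f :: "dir \<Rightarrow> 'q + 'q \<times> 's"
    by (metis image_empty image_insert)
  then show ?thesis
    by (simp add: ga_mbp_def split: trans.split)
qed

lemma kind_Inl: "kind M (Inl q) = Prob"
  by (simp add: ga_mbp_def)

lemma kind_Inr: "kind M (Inr (q, a)) = (if ex_trans (\<delta> q a) then BEx else BAll)"
  by (simp add: ga_mbp_def split: trans.split)

lemma par_simps: "par M (Inl q) = \<pi> q" "par M (Inr (q, a)) = \<pi> q"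
  by (simp_all add: ga_mbp_def)

lemma prob_Inl: "prob M (Inl q) = map_pmf (\<lambda>a. Inr (q, a)) (pmf_of_set UNIV)"
  by (simp add: ga_mbp_def)

text \<open>The analogue of \<open>vertex\<close> that reads the letters from \<open>c\<close>
  instead of a tree. It is total, so measurability holds on the whole space.\<close>

primrec address :: "(('q + 'q \<times> 's) list \<Rightarrow> 'q + 'q \<times> 's) \<Rightarrow> dir list \<Rightarrow> ('q + 'q \<times> 's) list" where
  "address c [] = []"
| "address c (d # v) =
    address c v @ [c (address c v), Inl (target (case_prod \<delta> (projr (c (address c v)))) d)]"

definition tree_of :: "(('q + 'q \<times> 's) list \<Rightarrow> 'q + 'q \<times> 's) \<Rightarrow> dir list \<Rightarrow> 's" where
  "tree_of c x = snd (projr (c (address c (rev x))))"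

text \<open>Holds almost surely, but arbitrary points of the product space need not respect the supports of
  the distributions.\<close>

definition consistent :: "(('q + 'q \<times> 's) list \<Rightarrow> 'q + 'q \<times> 's) \<Rightarrow> bool" where
  "consistent c \<longleftrightarrow> (\<forall>w q. lbl (Inl q0) w = Inl q \<longrightarrow> (\<exists>a. c w = Inr (q, a)))"

lemma address_tree_of:
  assumes "consistent c"
  shows "address c v = vertex q0 \<delta> (tree_of c) v"
    and "c (vertex q0 \<delta> (tree_of c) v) = Inr (state q0 \<delta> (tree_of c) v, tree_of c (rev v))"
proof -
  \<comment> \<open>Stated as an implication because the induction for the first claim uses it at
    shorter vertices.\<close>
  have *: "c (vertex q0 \<delta> (tree_of c) v) = Inr (state q0 \<delta> (tree_of c) v, tree_of c (rev v))"
    if "address c v = vertex q0 \<delta> (tree_of c) v" for v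
  proof -
    obtain a where a: "c (vertex q0 \<delta> (tree_of c) v) = Inr (state q0 \<delta> (tree_of c) v, a)"
      using assms unfolding consistent_def by (metis lbl_vertex)
    then have "tree_of c (rev v) = a" using that by (simp add: tree_of_def)
    with a show ?thesis by simp
  qed
  show "address c v = vertex q0 \<delta> (tree_of c) v" for v
    by (induction v) (simp_all add: *)
  then show "c (vertex q0 \<delta> (tree_of c) v) = Inr (state q0 \<delta> (tree_of c) v, tree_of c (rev v))"
    by (rule *)
qed

text \<open>The branching play spends two moves per direction, the random letter and the chosen
  child. The strategies are constrained only at the mid vertices actually visited.\<close>

lemma bp_play_vertex:
  assumes c: "consistent c" and t: "t = tree_of c" and 0: "\<rho> 0 = []"
    and st: "\<And>n. \<exists>d. \<rho> (Suc n) = d # \<rho> n"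
    and follow: "\<And>n. (if \<rho> n \<in> ex_nodes q0 \<delta> t then \<sigma> else \<tau>) (mid_vertex q0 \<delta> t (\<rho> n)) =
      Inl (state q0 \<delta> t (\<rho> (Suc n)))"
  shows "bp_play M (Inl q0) c \<sigma> \<tau> (2 * n) = vertex q0 \<delta> t (\<rho> n)"
    and "bp_play M (Inl q0) c \<sigma> \<tau> (Suc (2 * n)) = mid_vertex q0 \<delta> t (\<rho> n)"
proof -
  have mid: "bp_play M (Inl q0) c \<sigma> \<tau> (Suc m) = mid_vertex q0 \<delta> t v"
    if "bp_play M (Inl q0) c \<sigma> \<tau> m = vertex q0 \<delta> t v" for m v
    using that address_tree_of(2)[OF c, of v]
    by (simp add: t lbl_vertex kind_Inl mid_vertex_def)
  show *: "bp_play M (Inl q0) c \<sigma> \<tau> (2 * n) = vertex q0 \<delta> t (\<rho> n)" for n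
  proof (induction n)
    case 0
    then show ?case by (simp add: assms(3))
  next
    case (Suc n)
    obtain d where d: "\<rho> (Suc n) = d # \<rho> n" using st by blast
    have "bp_play M (Inl q0) c \<sigma> \<tau> (Suc (Suc (2 * n))) = vertex q0 \<delta> t (\<rho> (Suc n))"
      using mid[OF Suc] follow[of n]
      by (subst bp_play.simps)
        (auto simp: lbl_mid_vertex kind_Inr ex_nodes_def d vertex_Cons simp del: bp_play.simps vertex.simps state.simps split: if_splits)
    then show ?case by simp
  qed
  show "bp_play M (Inl q0) c \<sigma> \<tau> (Suc (2 * n)) = mid_vertex q0 \<delta> t (\<rho> n)"
    by (rule mid[OF *])
qed

lemma bp_accepts_iff:
  assumes "consistent c" and t: "t = tree_of c" and "\<rho> 0 = []"
    and "\<And>n. \<exists>d. \<rho> (Suc n) = d # \<rho> n"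
    and "\<And>n. (if \<rho> n \<in> ex_nodes q0 \<delta> t then \<sigma> else \<tau>) (mid_vertex q0 \<delta> t (\<rho> n)) =
      Inl (state q0 \<delta> t (\<rho> (Suc n)))"
  shows "parity_accepts (par M) (\<lambda>n. lbl (Inl q0) (bp_play M (Inl q0) c \<sigma> \<tau> n)) \<longleftrightarrow>
    dominant even (\<lambda>n. \<pi> (state q0 \<delta> t (\<rho> n)))"
proof -
  have "par M (lbl (Inl q0) (bp_play M (Inl q0) c \<sigma> \<tau> n)) = \<pi> (state q0 \<delta> t (\<rho> (n div 2)))" for n
    using bp_play_vertex[OF assms]
    by (cases "even n") (auto elim!: evenE oddE simp: par_simps lbl_vertex lbl_mid_vertex)
  then show ?thesis
    using dominant_div2[of even "\<lambda>n. \<pi> (state q0 \<delta> t (\<rho> n))"]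
    by (simp add: parity_accepts_iff_dominant)
qed

lemma bp_ex_wins_iff_tree_wins:
  assumes c: "consistent c"
  shows "bp_ex_wins M (Inl q0) c \<longleftrightarrow> tree_wins q0 \<delta> \<pi> (tree_of c)"
proof
  let ?t = "tree_of c"
  let ?E = "ex_nodes q0 \<delta> ?t" and ?m = "mid_vertex q0 \<delta> ?t" and ?s = "state q0 \<delta> ?t"
  let ?tgt = "\<lambda>v d. target (\<delta> (?s v) (?t (rev v))) d"
  assume "bp_ex_wins M (Inl q0) c"
  then obtain \<sigma> where legal: "\<And>w. kind M (lbl (Inl q0) w) = BEx \<Longrightarrow> \<sigma> w \<in> succ M (lbl (Inl q0) w)"
    and \<sigma>: "\<And>\<tau>. (\<And>w. kind M (lbl (Inl q0) w) = BAll \<Longrightarrow> \<tau> w \<in> succ M (lbl (Inl q0) w)) \<Longrightarrow>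
         parity_accepts (par M) (\<lambda>n. lbl (Inl q0) (bp_play M (Inl q0) c \<sigma> \<tau> n))"
    unfolding bp_ex_wins_def by blast
  \<comment> \<open>Legality of \<open>\<sigma>\<close> ensures that its move is the target of some
    direction.\<close>
  define S where "S v = (SOME d. \<sigma> (?m v) = Inl (?tgt v d))" for v
  have S: "\<sigma> (?m v) = Inl (?tgt v (S v))" if "v \<in> ?E" for v
  proof -
    have "\<sigma> (?m v) \<in> succ M (lbl (Inl q0) (?m v))"
      using that by (intro legal) (simp add: lbl_mid_vertex kind_Inr ex_nodes_def)
    then have "\<exists>d. \<sigma> (?m v) = Inl (?tgt v d)" by (auto simp: lbl_mid_vertex succ_Inr)
    then show ?thesis unfolding S_def by (rule someI_ex)
  qed
  have "dominant even (\<lambda>n. \<pi> (?s (\<rho> n)))"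
    if 0: "\<rho> 0 = []" and st: "\<And>n. step ?E S (\<rho> n) (\<rho> (Suc n))" for \<rho>
  proof -
    have len: "length (\<rho> n) = n" for n
      using length_path[of n ?E _ \<rho> n, OF st] 0 by simp
    \<comment> \<open>The opponent replays \<open>\<rho>\<close>: the mid vertex of
      \<open>\<rho> n\<close> has length \<open>2 * n + 1\<close>, whose half is \<open>n\<close>.
      Taking a target at the label of \<open>w\<close> keeps the move legal at every opponent
      vertex.\<close>
    define \<tau> :: "('q + 'q \<times> 's) list \<Rightarrow> 'q + 'q \<times> 's" where
      "\<tau> w = Inl (target (case_prod \<delta> (projr (lbl (Inl q0) w))) (hd (\<rho> (Suc (length w div 2)))))" for w
    have "parity_accepts (par M) (\<lambda>n. lbl (Inl q0) (bp_play M (Inl q0) c \<sigma> \<tau> n))"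
    proof (rule \<sigma>)
      fix w assume "kind M (lbl (Inl q0) w) = BAll"
      then show "\<tau> w \<in> succ M (lbl (Inl q0) w)"
        by (cases "lbl (Inl q0) w") (auto simp: \<tau>_def kind_Inl succ_Inr)
    qed
    moreover have "(if \<rho> n \<in> ?E then \<sigma> else \<tau>) (?m (\<rho> n)) = Inl (?s (\<rho> (Suc n)))" for n
    proof -
      obtain d where d: "\<rho> (Suc n) = d # \<rho> n" "\<rho> n \<in> ?E \<longrightarrow> d = S (\<rho> n)"
        using st[of n] by (auto simp: step_def)
      have "length (?m (\<rho> n)) div 2 = n" by (simp add: mid_vertex_def length_vertex len)
      then show ?thesis using d S[of "\<rho> n"] by (auto simp: \<tau>_def lbl_mid_vertex)
    qed
    moreover have "\<exists>d. \<rho> (Suc n) = d # \<rho> n" for n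
      using st[of n] by (auto simp: step_def)
    ultimately show ?thesis
      using bp_accepts_iff[of c ?t \<rho> \<sigma> \<tau>, OF c refl 0] by blast
  qed
  then show "tree_wins q0 \<delta> \<pi> ?t"
    unfolding tree_wins_def ex_wins_def by blast
next
  let ?t = "tree_of c"
  let ?E = "ex_nodes q0 \<delta> ?t" and ?m = "mid_vertex q0 \<delta> ?t" and ?s = "state q0 \<delta> ?t"
  let ?tgt = "\<lambda>v d. target (\<delta> (?s v) (?t (rev v))) d"
  assume "tree_wins q0 \<delta> \<pi> ?t"
  then obtain S where S: "\<And>\<rho>. \<rho> 0 = [] \<Longrightarrow> (\<And>n. step ?E S (\<rho> n) (\<rho> (Suc n))) \<Longrightarrow>
      dominant even (\<lambda>n. \<pi> (?s (\<rho> n)))"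
    unfolding tree_wins_def ex_wins_def by blast
  \<comment> \<open>Injectivity recovers the tree vertex from a mid vertex; at other vertices the
    direction is arbitrary but the move stays legal.\<close>
  define \<sigma> :: "('q + 'q \<times> 's) list \<Rightarrow> 'q + 'q \<times> 's" where
    "\<sigma> w = Inl (target (case_prod \<delta> (projr (lbl (Inl q0) w))) (S (inv (vertex q0 \<delta> ?t) (butlast w))))" for w
  have \<sigma>: "\<sigma> (?m v) = Inl (?tgt v (S v))" for v
  proof -
    have "butlast (?m v) = vertex q0 \<delta> ?t v" by (simp add: mid_vertex_def)
    then show ?thesis by (simp add: \<sigma>_def lbl_mid_vertex inj_vertex)
  qed
  have "\<sigma> w \<in> succ M (lbl (Inl q0) w)" if "kind M (lbl (Inl q0) w) = BEx" for w
    using that by (cases "lbl (Inl q0) w") (auto simp: \<sigma>_def kind_Inl succ_Inr)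
  moreover have "parity_accepts (par M) (\<lambda>n. lbl (Inl q0) (bp_play M (Inl q0) c \<sigma> \<tau> n))"
    if legal: "\<And>w. kind M (lbl (Inl q0) w) = BAll \<Longrightarrow> \<tau> w \<in> succ M (lbl (Inl q0) w)" for \<tau>
  proof -
    define R where "R v = (SOME d. \<tau> (?m v) = Inl (?tgt v d))" for v
    have R: "\<tau> (?m v) = Inl (?tgt v (R v))" if "v \<notin> ?E" for v
    proof -
      have "\<tau> (?m v) \<in> succ M (lbl (Inl q0) (?m v))"
        using that by (intro legal) (simp add: lbl_mid_vertex kind_Inr ex_nodes_def)
      then have "\<exists>d. \<tau> (?m v) = Inl (?tgt v d)" by (auto simp: lbl_mid_vertex succ_Inr)
      then show ?thesis unfolding R_def by (rule someI_ex)
    qed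
    define \<rho> where "\<rho> = rec_nat [] (\<lambda>_ v. (if v \<in> ?E then S v else R v) # v)"
    have \<rho>: "\<rho> 0 = []" "\<rho> (Suc n) = (if \<rho> n \<in> ?E then S (\<rho> n) else R (\<rho> n)) # \<rho> n" for n
      by (simp_all add: \<rho>_def)
    have "dominant even (\<lambda>n. \<pi> (?s (\<rho> n)))"
      by (rule S) (auto simp: \<rho> step_def)
    moreover have "(if \<rho> n \<in> ?E then \<sigma> else \<tau>) (?m (\<rho> n)) = Inl (?s (\<rho> (Suc n)))" for n
      using \<sigma> R by (simp add: \<rho>)
    moreover have "\<exists>d. \<rho> (Suc n) = d # \<rho> n" for n by (simp add: \<rho>)
    ultimately show ?thesis
      using bp_accepts_iff[of c ?t \<rho> \<sigma> \<tau>, OF c refl \<rho>(1)] by blast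
  qed
  ultimately show "bp_ex_wins M (Inl q0) c"
    unfolding bp_ex_wins_def by blast
qed

section \<open>Transport of the measure\<close>

abbreviation "N \<equiv> mbp_space M (Inl q0)"

lemma space_mbp: "space N = UNIV"
  by (simp add: mbp_space_def space_PiM)

lemma measurable_component_mbp: "(\<lambda>c. c w) \<in> N \<rightarrow>\<^sub>M count_space UNIV"
proof -
  have "(\<lambda>c. c w) \<in> N \<rightarrow>\<^sub>M measure_pmf (prob M (lbl (Inl q0) w))"
    unfolding mbp_space_def by (rule measurable_component_singleton) simp
  then show ?thesis by (simp cong: measurable_cong_sets)
qed

lemma AE_consistent: "AE c in N. consistent c"
proof -
  interpret PP: product_prob_space "\<lambda>w. measure_pmf (prob M (lbl (Inl q0) w))" UNIV
    by unfold_locales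
  have "AE c in N. lbl (Inl q0) w = Inl q \<longrightarrow> (\<exists>a. c w = Inr (q, a))" for w q
  proof (cases "lbl (Inl q0) w = Inl q")
    case True
    have "AE x in measure_pmf (prob M (lbl (Inl q0) w)). \<exists>a. x = Inr (q, a)"
      unfolding True prob_Inl by (auto simp: AE_measure_pmf_iff)
    then have "AE c in N. \<exists>a. c w = Inr (q, a)"
      unfolding mbp_space_def by (rule PP.AE_component[OF UNIV_I])
    then show ?thesis by auto
  qed simp
  then show ?thesis unfolding consistent_def by (simp add: AE_all_countable)
qed

text \<open>The coordinate that is read depends on \<open>c\<close> itself, but it ranges over
  countably many lists, so the map can be split by its value.\<close>

lemma measurable_choice: "(\<lambda>c. c (address c v)) \<in> N \<rightarrow>\<^sub>M count_space UNIV"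
proof -
  have *: "(\<lambda>c. c (f c)) \<in> N \<rightarrow>\<^sub>M count_space UNIV" if "f \<in> N \<rightarrow>\<^sub>M count_space UNIV" for f
    by (rule measurable_compose_countable[OF measurable_component_mbp that])
  have **: "(\<lambda>c. address c v) \<in> N \<rightarrow>\<^sub>M count_space UNIV" for v
  proof (induction v)
    case (Cons d v)
    from measurable_count_space_binop[OF this *[OF this],
        of "\<lambda>w y. w @ [y, Inl (target (case_prod \<delta> (projr y)) d)]"]
    show ?case by simp
  qed simp
  show "(\<lambda>c. c (address c v)) \<in> N \<rightarrow>\<^sub>M count_space UNIV"
    by (rule *[OF **])
qed

lemma measurable_tree_of: "tree_of \<in> N \<rightarrow>\<^sub>M coin_measure"
  unfolding coin_measure_def
proof (rule measurable_PiM_single')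
  fix x
  have "(\<lambda>c. tree_of c x) \<in> N \<rightarrow>\<^sub>M count_space UNIV"
    unfolding tree_of_def by (rule measurable_compose[OF measurable_choice]) simp
  then show "(\<lambda>c. tree_of c x) \<in> N \<rightarrow>\<^sub>M measure_pmf (pmf_of_set UNIV)"
    by (simp cong: measurable_cong_sets)
qed simp

text \<open>Trades addresses depending on \<open>c\<close> for the fixed vertices of
  \<open>a\<close>, turning the event into a cylinder of the product space.\<close>

lemma tree_of_agrees_iff:
  assumes c: "consistent c"
  shows "(\<forall>x. length x < n \<longrightarrow> tree_of c x = a x) \<longleftrightarrow>
    (\<forall>v. length v < n \<longrightarrow> c (vertex q0 \<delta> a v) = Inr (state q0 \<delta> a v, a (rev v)))"
proof (intro iffI allI impI)
  fix v :: "dir list"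
  assume eq: "\<forall>x. length x < n \<longrightarrow> tree_of c x = a x" and v: "length v < n"
  then have "\<And>x. length x < length v \<Longrightarrow> tree_of c x = a x" by simp
  from vertex_cong[of v "tree_of c" a, OF this, of q0 \<delta>] show "c (vertex q0 \<delta> a v) = Inr (state q0 \<delta> a v, a (rev v))"
    using address_tree_of(2)[OF c, of v] eq v by simp
next
  fix x
  assume eq: "\<forall>v. length v < n \<longrightarrow> c (vertex q0 \<delta> a v) = Inr (state q0 \<delta> a v, a (rev v))"
  show "length x < n \<Longrightarrow> tree_of c x = a x"
  proof (induction "length x" arbitrary: x rule: less_induct)
    case less
    then have "\<And>y. length y < length (rev x) \<Longrightarrow> tree_of c y = a y" by simp
    from vertex_cong[of "rev x" "tree_of c" a, OF this, of q0 \<delta>] show ?case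
      using address_tree_of(2)[OF c, of "rev x"] eq less.prems by simp
  qed
qed

text \<open>By \<open>inj_vertex\<close> the constraints concern pairwise distinct, hence
  independent, coordinates, and each has probability one over the alphabet size.\<close>

lemma emeasure_mbp_cylinder:
  "emeasure N {c. \<forall>v. length v < n \<longrightarrow> c (vertex q0 \<delta> a v) = Inr (state q0 \<delta> a v, a (rev v))} =
    ennreal (1 / real CARD('s)) ^ card {v :: dir list. length v < n}"
proof -
  interpret PP: product_prob_space "\<lambda>w. measure_pmf (prob M (lbl (Inl q0) w))" UNIV
    by unfold_locales
  let ?D = "{v :: dir list. length v < n}" and ?f = "vertex q0 \<delta> a"
  let ?s = "\<lambda>v. Inr (state q0 \<delta> a v, a (rev v))"
  have fin: "finite ?D" by (rule finite_length_less)
  have eq: "{c. \<forall>v. length v < n \<longrightarrow> c (?f v) = ?s v} =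
      {c \<in> space N. \<forall>w\<in>?f ` ?D. c w \<in> {?s (inv ?f w)}}"
    using inj_vertex[of a] by (auto simp: space_mbp)
  have "emeasure N {c \<in> space N. \<forall>w\<in>?f ` ?D. c w \<in> {?s (inv ?f w)}} =
      (\<Prod>w\<in>?f ` ?D. emeasure (measure_pmf (prob M (lbl (Inl q0) w))) {?s (inv ?f w)})"
    unfolding mbp_space_def
    by (rule PP.emeasure_PiM_Collect[of "?f ` ?D" "\<lambda>w. {?s (inv ?f w)}", OF subset_UNIV finite_imageI[OF fin]]) simp
  also have "\<dots> = (\<Prod>v\<in>?D. emeasure (measure_pmf (prob M (lbl (Inl q0) (?f v)))) {?s v})"
    by (simp only: prod.reindex[OF inj_on_subset[OF inj_vertex subset_UNIV]] comp_def inv_f_f[OF inj_vertex])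
  also have "\<dots> = (\<Prod>v\<in>?D. ennreal (1 / real CARD('s)))"
  proof (rule prod.cong[OF refl])
    fix v
    have "pmf (prob M (lbl (Inl q0) (?f v))) (?s v) = 1 / real CARD('s)"
      unfolding lbl_vertex prob_Inl
      using pmf_map_inj'[of "\<lambda>x. Inr (state q0 \<delta> a v, x)" "pmf_of_set UNIV" "a (rev v)"]
      by (simp add: inj_def)
    then show "emeasure (measure_pmf (prob M (lbl (Inl q0) (?f v)))) {?s v} = ennreal (1 / real CARD('s))"
      by (simp add: emeasure_pmf_single)
  qed
  also have "\<dots> = ennreal (1 / real CARD('s)) ^ card ?D" by (rule prod_constant)
  finally show ?thesis unfolding eq .
qed

text \<open>It suffices to compare cylinders, whose preimages are, up to the null set of
  inconsistent \<open>c\<close>, the events of \<open>emeasure_mbp_cylinder\<close>.\<close>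

lemma distr_tree_of: "distr N coin_measure tree_of = coin_measure"
proof (rule coin_measure_eqI)
  fix n and a :: "dir list \<Rightarrow> 's"
  have [measurable]: "{t. \<forall>x. length x < n \<longrightarrow> t x = a x} \<in> sets coin_measure"
    by (rule cylinder_sets_coin)
  have "emeasure (distr N coin_measure tree_of) {t. \<forall>x. length x < n \<longrightarrow> t x = a x} =
      emeasure N {c. \<forall>x. length x < n \<longrightarrow> tree_of c x = a x}"
    using measurable_tree_of by (subst emeasure_distr) (auto simp: space_mbp vimage_def)
  also have "\<dots> =
      emeasure N {c. \<forall>v. length v < n \<longrightarrow> c (vertex q0 \<delta> a v) = Inr (state q0 \<delta> a v, a (rev v))}"
  proof (rule emeasure_eq_AE)
    show "AE c in N. c \<in> {c. \<forall>x. length x < n \<longrightarrow> tree_of c x = a x} \<longleftrightarrow>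
      c \<in> {c. \<forall>v. length v < n \<longrightarrow> c (vertex q0 \<delta> a v) = Inr (state q0 \<delta> a v, a (rev v))}"
      using AE_consistent by eventually_elim (simp add: tree_of_agrees_iff)
    have "tree_of -` {t. \<forall>x. length x < n \<longrightarrow> t x = a x} \<inter> space N \<in> sets N"
      using measurable_tree_of by measurable
    then show "{c. \<forall>x. length x < n \<longrightarrow> tree_of c x = a x} \<in> sets N"
      by (simp add: vimage_def space_mbp)
    have "{c. \<forall>v. length v < n \<longrightarrow> c (vertex q0 \<delta> a v) = Inr (state q0 \<delta> a v, a (rev v))} =
        {c \<in> space N. \<forall>v\<in>{v. length v < n}. c (vertex q0 \<delta> a v) = Inr (state q0 \<delta> a v, a (rev v))}"
      by (simp add: space_mbp)
    also have "\<dots> \<in> sets N"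
    proof (rule sets.sets_Collect_finite_All[OF _ finite_length_less])
      fix v
      show "{c \<in> space N. c (vertex q0 \<delta> a v) = Inr (state q0 \<delta> a v, a (rev v))} \<in> sets N"
        using measurable_sets[OF measurable_component_mbp[of "vertex q0 \<delta> a v"],
            of "{Inr (state q0 \<delta> a v, a (rev v))}"]
        by (simp add: vimage_def space_mbp)
    qed
    finally show "{c. \<forall>v. length v < n \<longrightarrow> c (vertex q0 \<delta> a v) = Inr (state q0 \<delta> a v, a (rev v))} \<in> sets N" .
  qed
  also have "\<dots> = ennreal (1 / real CARD('s)) ^ card {x :: dir list. length x < n}"
    by (rule emeasure_mbp_cylinder)
  finally show "emeasure (distr N coin_measure tree_of) {t. \<forall>x. length x < n \<longrightarrow> t x = a x} =
      emeasure coin_measure {t. \<forall>x. length x < n \<longrightarrow> t x = a x}"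
    by (simp only: emeasure_coin_cylinder)
qed simp

text \<open>Passing to completions requires null sets to have null preimages, which
  \<open>distr_tree_of\<close> provides.\<close>

lemma measurable_completion_tree_of: "tree_of \<in> completion N \<rightarrow>\<^sub>M completion coin_measure"
  by (rule completion.measurable_completion2)
    (simp_all add: measurable_completion measurable_tree_of distr_completion distr_tree_of)

lemma mbp_win_set_AE: "AE c in completion N. c \<in> tree_of -` ga_lang q0 \<delta> \<pi> \<inter> space (completion N) \<longleftrightarrow>
    c \<in> mbp_win_set M (Inl q0)"
  using AE_completion[OF AE_consistent]
  by eventually_elim (simp add: mbp_win_set_def ga_lang_def space_mbp bp_ex_wins_iff_tree_wins
      ga_accepts_iff_tree_wins)

text \<open>Inherited from the language: the winning set agrees almost everywhere with the preimage
  of the language, and the completion is closed under such changes.\<close>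

lemma mbp_win_set_measurable: "mbp_win_set M (Inl q0) \<in> sets (completion N)"
  by (rule completion.in_sets_AE[OF mbp_win_set_AE measurable_sets[OF measurable_completion_tree_of ga_lang_measurable]])
    (simp add: space_mbp)

lemma measure_ga_lang: "measure (completion coin_measure) (ga_lang q0 \<delta> \<pi>) = mbp_val M (Inl q0)"
proof -
  have "completion coin_measure = distr (completion N) (completion coin_measure) tree_of"
    using completion.completion_distr_eq[of tree_of N coin_measure] measurable_tree_of
    by (simp add: measurable_completion distr_completion distr_tree_of)
  then have "measure (completion coin_measure) (ga_lang q0 \<delta> \<pi>) =
      measure (distr (completion N) (completion coin_measure) tree_of) (ga_lang q0 \<delta> \<pi>)"
    by (rule arg_cong)
  also have "\<dots> = measure (completion N) (tree_of -` ga_lang q0 \<delta> \<pi> \<inter> space (completion N))"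
    by (rule measure_distr[OF measurable_completion_tree_of ga_lang_measurable])
  also have "\<dots> = measure (completion N) (mbp_win_set M (Inl q0))"
    by (rule measure_eq_AE[OF mbp_win_set_AE measurable_sets[OF measurable_completion_tree_of ga_lang_measurable]
          mbp_win_set_measurable])
  finally show ?thesis by (simp add: mbp_val_def)
qed

end

theorem theorem4:
  fixes q0 :: "'q::finite" and \<delta> :: "'q \<Rightarrow> 's::finite \<Rightarrow> 'q trans" and \<pi> :: "'q \<Rightarrow> nat"
  assumes distinct_succ: "\<And>q a qL qR. \<delta> q a = Or qL qR \<or> \<delta> q a = And qL qR \<Longrightarrow> qL \<noteq> qR"
  shows "ga_lang q0 \<delta> \<pi> \<in> sets (completion (coin_measure :: (dir list \<Rightarrow> 's) measure))
       \<and> mbp_win_set (ga_mbp \<delta> \<pi>) (Inl q0) \<in> sets (completion (mbp_space (ga_mbp \<delta> \<pi>) (Inl q0)))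
       \<and> measure (completion coin_measure) (ga_lang q0 \<delta> \<pi>) = mbp_val (ga_mbp \<delta> \<pi>) (Inl q0)"
proof -
  interpret distinct_targets q0 \<delta> \<pi>
    by unfold_locales (rule distinct_succ)
  show ?thesis
    using ga_lang_measurable mbp_win_set_measurable measure_ga_lang by blast
qed

end
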